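(* Let $G$ be ${\mathbb Z}_{\geq 0}$ or ${\mathbb Z}$, let $X$ be a compact metrizable space with metric $\rho$, and let $T:X\to X$ be a surjective continuous map (a homeomorphism if $G={\mathbb Z}$). Suppose that $k\geq 2$ and $(x_1,\dots,x_k)$ is an IE-tuple in $X^k\setminus\Delta_k(X)$. For each $1\le j\le k$ let $A_j$ be a neighbourhood of $x_j$. Then there exist a $\delta>0$ and, for each $j=1,\dots,k$, a Cantor set $Z_j\subseteq A_j$ such that, with $Z:=\bigcup_j Z_j$: (1) every nonempty finite tuple of points in $Z$ is an IE-tuple; (2) for all $m\in{\mathbb N}$, all distinct $y_1,\dots,y_m\in Z$, and all $y_1',\dots,y_m'\in Z$, one has $\liminf_{n\to\infty}\max_{1\le i\le m}\rho(T^ny_i,y_i')=0$.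
   Context: $\Delta_k(X)=\{(x,\dots,x):x\in X\}$. For a tuple $(A_1,\dots,A_l)$ of subsets of $X$, $J\subseteq G$ is an independence set if for every nonempty finite $I\subseteq J$ and $\sigma:I\to\{1,\dots,l\}$, $\bigcap_{s\in I}T^{-s}A_{\sigma(s)}\neq\emptyset$. A set $I\subseteq{\mathbb Z}$ has positive density if $\lim_n|I\cap\{-n,\dots,n\}|/(2n+1)$ exists and is nonzero; $I\subseteq{\mathbb Z}_{\ge0}$ has positive density if $\lim_n|I\cap\{0,\dots,n\}|/(n+1)$ exists and is nonzero. A tuple $(x_1,\dots,x_l)\in X^l$ (any $l\ge1$) is an IE-tuple if for every product neighbourhood $U_1\times\cdots\times U_l$ of it, $(U_1,\dots,U_l)$ has an independence set of positive density. *)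

theory Defs
  imports "HOL-Analysis.Analysis"
begin

definition actG :: "bool \<Rightarrow> int set" where
  "actG isZ = (if isZ then UNIV else {0..})"

definition Tpow :: "'a set \<Rightarrow> ('a \<Rightarrow> 'a) \<Rightarrow> int \<Rightarrow> 'a \<Rightarrow> 'a" where
  "Tpow X T s = (if s \<ge> 0 then T ^^ nat s else inv_into X T ^^ nat (- s))"

definition preim :: "'a set \<Rightarrow> ('a \<Rightarrow> 'a) \<Rightarrow> int \<Rightarrow> 'a set \<Rightarrow> 'a set" where
  "preim X T s A = {x \<in> X. Tpow X T s x \<in> A}"

definition indep_set :: "'a set \<Rightarrow> ('a \<Rightarrow> 'a) \<Rightarrow> 'a set list \<Rightarrow> int set \<Rightarrow> bool" where
  "indep_set X T As J \<longleftrightarrow>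
     (\<forall>I \<sigma>. I \<noteq> {} \<and> finite I \<and> I \<subseteq> J \<and> (\<forall>s\<in>I. \<sigma> s < length As) \<longrightarrow>
        (\<Inter>s\<in>I. preim X T s (As ! \<sigma> s)) \<noteq> {})"

definition pos_density :: "bool \<Rightarrow> int set \<Rightarrow> bool" where
  "pos_density isZ I \<longleftrightarrow>
     (if isZ then (\<exists>d::real. d \<noteq> 0 \<and>
         (\<lambda>n::nat. real (card (I \<inter> {- int n..int n})) / real (2 * n + 1)) \<longlonglongrightarrow> d)
      else (\<exists>d::real. d \<noteq> 0 \<and>
         (\<lambda>n::nat. real (card (I \<inter> {0..int n})) / real (n + 1)) \<longlonglongrightarrow> d))"

definition nbhd :: "'a::topological_space set \<Rightarrow> 'a \<Rightarrow> 'a set \<Rightarrow> bool" where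
  "nbhd X x A \<longleftrightarrow> A \<subseteq> X \<and> (\<exists>U. openin (top_of_set X) U \<and> x \<in> U \<and> U \<subseteq> A)"

definition IE_tuple :: "bool \<Rightarrow> 'a::topological_space set \<Rightarrow> ('a \<Rightarrow> 'a) \<Rightarrow> 'a list \<Rightarrow> bool" where
  "IE_tuple isZ X T xs \<longleftrightarrow> xs \<noteq> [] \<and> set xs \<subseteq> X \<and>
     (\<forall>Us. length Us = length xs \<and> (\<forall>i<length xs. nbhd X (xs ! i) (Us ! i)) \<longrightarrow>
        (\<exists>J \<subseteq> actG isZ. indep_set X T Us J \<and> pos_density isZ J))"

definition cantor_ternary :: "real set" where
  "cantor_ternary = range (\<lambda>a::nat \<Rightarrow> bool. \<Sum>n. (if a n then 2 else 0) / 3 ^ Suc n)"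

definition is_cantor_set :: "'a::topological_space set \<Rightarrow> bool" where
  "is_cantor_set Z \<longleftrightarrow> Z homeomorphic cantor_ternary"

end

theory Submission
  imports Defs
begin

text \<open>
  A tuple of sets has an independence set of positive density iff it has, for infinitely many
  \<open>n\<close>, an independence set of size at least \<open>c n\<close> inside \<open>[0, n)\<close>: independence has finite character
  and is shift invariant, so a set whose density exists and is maximal can be built from pieces of
  finite independence sets all of whose initial segments are dense.

  This property survives splitting one member of the tuple into two. For \<open>k\<close>-valued patterns along
  \<open>I\<close>, count how many families of the form \<open>{s. s z \<noteq> f z for all z}\<close> are needed to cover
  them. For all \<open>k ^ |I|\<close> patterns this number is at least \<open>(k / (k - 1)) ^ |I|\<close>, and it is
  submultiplicative under the splitting, so it stays exponential for one of the two parts; an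
  exponential covering number forces exponentially many, hence linearly large, shattered subsets
  of \<open>I\<close>. By compactness members of the tuple can thus be replaced by closed sets of small diameter.

  If \<open>J\<close> is an independence set of positive density, then for finitely many \<open>h \<gamma>\<close> as large as desired
  the set of \<open>s\<close> with \<open>s\<close> and all \<open>s + h \<gamma>\<close> in \<open>J\<close> has positive upper density. Hence the sets
  \<open>A (j div 2) \<inter> (\<Inter>\<gamma>. T^{-h \<gamma>} (A (\<gamma> j)))\<close>, with \<open>\<gamma>\<close> ranging over all maps from new to
  old indices, are again independent along a dense set of times. Iterating and shrinking yields a
  binary Cantor scheme in which every level can be sent into the previous one along an arbitrary
  map of indices; this gives both claims.
\<close>

section \<open>Avoiding numbers and shattered sets\<close>

text \<open>Each \<open>f\<close> stands for the set of patterns that differ from it at every point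
  of \<open>Z\<close>. Members of \<open>S\<close> may take values \<open>\<ge> k\<close>; such a
  value never meets \<open>f\<close> and so acts as an undetermined coordinate.\<close>

definition avoiding_cover :: "nat \<Rightarrow> 'i set \<Rightarrow> ('i \<Rightarrow> nat) set \<Rightarrow> ('i \<Rightarrow> nat) set \<Rightarrow> bool" where
  "avoiding_cover k Z S F \<longleftrightarrow>
     finite F \<and> (\<forall>f\<in>F. \<forall>z\<in>Z. f z < k) \<and> (\<forall>s\<in>S. \<exists>f\<in>F. \<forall>z\<in>Z. s z \<noteq> f z)"

definition avoiding_number :: "nat \<Rightarrow> 'i set \<Rightarrow> ('i \<Rightarrow> nat) set \<Rightarrow> nat" where
  "avoiding_number k Z S = (LEAST n. \<exists>F. avoiding_cover k Z S F \<and> card F = n)"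

text \<open>Shattering in the sense of Sauer and Shelah, with \<open>k\<close> colours in place of
  two.\<close>

definition shattered_sets :: "nat \<Rightarrow> 'i set \<Rightarrow> ('i \<Rightarrow> nat) set \<Rightarrow> 'i set set" where
  "shattered_sets k Z S =
     {W. W \<subseteq> Z \<and> (\<forall>\<sigma>. (\<forall>z\<in>W. \<sigma> z < k) \<longrightarrow> (\<exists>s\<in>S. \<forall>z\<in>W. s z = \<sigma> z))}"

lemma avoiding_number_le: "avoiding_cover k Z S F \<Longrightarrow> avoiding_number k Z S \<le> card F"
  unfolding avoiding_number_def by (rule Least_le) blast

lemma avoiding_cover_exists:
  assumes "finite Z" "2 \<le> k"
  shows "\<exists>F. avoiding_cover k Z S F"
proof -
  have "\<exists>f\<in>Z \<rightarrow>\<^sub>E {..<k}. \<forall>z\<in>Z. s z \<noteq> f z" for s :: "'a \<Rightarrow> nat"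
    using assms by (intro bexI[where x = "\<lambda>z\<in>Z. if s z = 0 then 1 else 0"]) auto
  then have "avoiding_cover k Z S (Z \<rightarrow>\<^sub>E {..<k})"
    using assms by (auto simp: avoiding_cover_def finite_PiE)
  then show ?thesis ..
qed

lemma avoiding_number_attained:
  assumes "finite Z" "2 \<le> k"
  obtains F where "avoiding_cover k Z S F" "card F = avoiding_number k Z S"
proof -
  have "\<exists>n F. avoiding_cover k Z S F \<and> card F = n"
    using avoiding_cover_exists[OF assms] by blast
  then have "\<exists>F. avoiding_cover k Z S F \<and> card F = avoiding_number k Z S"
    unfolding avoiding_number_def by (rule LeastI_ex)
  then show ?thesis using that by blast
qed

lemma avoiding_number_empty [simp]: "avoiding_number k Z {} = 0"
  using avoiding_number_le[of k Z "{}" "{}"] by (simp add: avoiding_cover_def)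

lemma avoiding_number_Un:
  assumes "finite Z" "2 \<le> k"
  shows "avoiding_number k Z (S \<union> S') \<le> avoiding_number k Z S + avoiding_number k Z S'"
proof -
  obtain F where F: "avoiding_cover k Z S F" "card F = avoiding_number k Z S"
    using avoiding_number_attained[OF assms] .
  obtain F' where F': "avoiding_cover k Z S' F'" "card F' = avoiding_number k Z S'"
    using avoiding_number_attained[OF assms] .
  have "avoiding_cover k Z (S \<union> S') (F \<union> F')"
    using F(1) F'(1) by (auto simp: avoiding_cover_def bex_Un)
  then show ?thesis
    using avoiding_number_le card_Un_le[of F F'] F(2) F'(2) by (metis le_trans)
qed

text \<open>Every \<open>f\<close> of a cover over \<open>Z\<close> can be given the value
  \<open>a\<close> at \<open>z\<close>; no member of \<open>S\<close> takes it there, so the new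
  coordinate costs nothing.\<close>

lemma avoiding_number_insert:
  assumes "finite Z" "2 \<le> k" "z \<notin> Z" "a < k" "\<And>s. s \<in> S \<Longrightarrow> s z \<noteq> a"
  shows "avoiding_number k (insert z Z) S \<le> avoiding_number k Z S"
proof -
  obtain F where F: "avoiding_cover k Z S F" "card F = avoiding_number k Z S"
    using avoiding_number_attained[OF assms(1,2)] .
  let ?F = "(\<lambda>f. f(z := a)) ` F"
  have "avoiding_cover k (insert z Z) S ?F"
    using F(1) assms(3-5) unfolding avoiding_cover_def
    by (auto simp: ball_Un) (metis (no_types, opaque_lifting))
  then have "avoiding_number k (insert z Z) S \<le> card ?F"
    by (rule avoiding_number_le)
  also have "\<dots> \<le> card F"
    using F(1) by (intro card_image_le) (simp add: avoiding_cover_def)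
  finally show ?thesis using F(2) by simp
qed

lemma finite_shattered_sets: "finite Z \<Longrightarrow> finite (shattered_sets k Z S)"
  by (rule finite_subset[of _ "Pow Z"]) (auto simp: shattered_sets_def)

lemma shattered_sets_mono:
  "S \<subseteq> S' \<Longrightarrow> Z \<subseteq> Z' \<Longrightarrow> shattered_sets k Z S \<subseteq> shattered_sets k Z' S'"
  unfolding shattered_sets_def by blast

text \<open>On the left, elements of all \<open>W a\<close> are counted \<open>k \<le> 2 * (k - 1)\<close> times and all other
  elements at most \<open>k - 1\<close> times.\<close>
lemma card_Union_plus_card_Inter:
  fixes W :: "nat \<Rightarrow> 'b set"
  assumes "2 \<le> k" "\<And>a. a < k \<Longrightarrow> finite (W a)"
  shows "(\<Sum>a<k. card (W a)) \<le> (k - 1) * (card (\<Union>a<k. W a) + card (\<Inter>a<k. W a))"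
proof -
  let ?U = "\<Union>a<k. W a" and ?I = "\<Inter>a<k. W a"
  have finU: "finite ?U" using assms(2) by auto
  have IU: "?I \<subseteq> ?U" using assms(1) by (force intro!: bexI[of _ 0])
  have "(\<Sum>a<k. card (W a)) = (\<Sum>a<k. \<Sum>x\<in>?U. of_bool (x \<in> W a))"
  proof (rule sum.cong)
    fix a assume "a \<in> {..<k}"
    then have "?U \<inter> {x. x \<in> W a} = W a" by auto
    then show "card (W a) = (\<Sum>x\<in>?U. of_bool (x \<in> W a))"
      using finU by (simp add: sum_of_bool_eq del: UN_simps)
  qed simp
  also have "\<dots> = (\<Sum>x\<in>?U. \<Sum>a<k. of_bool (x \<in> W a))"
    by (rule sum.swap)
  also have "\<dots> \<le> (\<Sum>x\<in>?U. (k - 1) + (k - 1) * of_bool (x \<in> ?I))"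
  proof (rule sum_mono)
    fix x assume "x \<in> ?U"
    have *: "(\<Sum>a<k. of_bool (x \<in> W a)) = card {a. a < k \<and> x \<in> W a}"
      by (simp add: sum_of_bool_eq Collect_conj_eq lessThan_def)
    show "(\<Sum>a<k. of_bool (x \<in> W a)) \<le> (k - 1) + (k - 1) * of_bool (x \<in> ?I)"
    proof (cases "x \<in> ?I")
      case True
      have "card {a. a < k \<and> x \<in> W a} \<le> card {..<k}"
        by (rule card_mono) auto
      then show ?thesis using True assms(1) * by simp
    next
      case False
      then obtain b where "b < k" "x \<notin> W b" by auto
      then have "card {a. a < k \<and> x \<in> W a} \<le> card ({..<k} - {b})"
        by (intro card_mono) auto
      then show ?thesis using \<open>b < k\<close> * by simp
    qed
  qed
  also have "\<dots> = (k - 1) * (card ?U + card ?I)"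
  proof -
    have "?U \<inter> {x. x \<in> ?I} = ?I" using IU by auto
    then have "(\<Sum>x\<in>?U. of_bool (x \<in> ?I)) = card ?I"
      using finU by (simp add: sum_of_bool_eq del: UN_simps INT_simps)
    then show ?thesis
      by (simp only: sum.distrib sum_distrib_left[symmetric] sum_constant distrib_left) simp
  qed
  finally show ?thesis .
qed

text \<open>A set shattered by one slice \<open>s z = a\<close> stays shattered, and a set shattered
  by all \<open>k\<close> slices stays so after \<open>z\<close> is added to it. The two kinds are
  disjoint, as only the second contains \<open>z\<close>, so the total is at least the size of the
  union plus that of the intersection.\<close>

lemma shattered_sets_branch:
  assumes "finite Z" "2 \<le> k" "z \<notin> Z"
    and "\<And>a. a < k \<Longrightarrow> r \<le> card (shattered_sets k Z {s \<in> S. s z = a})"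
  shows "k * r \<le> (k - 1) * card (shattered_sets k (insert z Z) S)"
proof -
  define W where "W a = shattered_sets k Z {s \<in> S. s z = a}" for a
  have fin: "finite (W a)" for a
    using assms(1) by (simp add: W_def finite_shattered_sets)
  have "k * r = (\<Sum>a<k. r)" by simp
  also have "\<dots> \<le> (\<Sum>a<k. card (W a))"
    using assms(4) by (intro sum_mono) (simp add: W_def)
  also have "\<dots> \<le> (k - 1) * (card (\<Union>a<k. W a) + card (\<Inter>a<k. W a))"
    using card_Union_plus_card_Inter fin assms(2) by blast
  also have "card (\<Union>a<k. W a) + card (\<Inter>a<k. W a) \<le> card (shattered_sets k (insert z Z) S)"
  proof -
    let ?I = "\<Inter>a<k. W a"
    have WZ: "V \<subseteq> Z" if "V \<in> W a" for V a
      using that by (auto simp: W_def shattered_sets_def)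
    have IW: "V \<in> W 0" if "V \<in> ?I" for V
      using that assms(2) by auto
    have finI: "finite ?I"
      using IW fin[of 0] by (meson finite_subset subsetI)
    have inj: "inj_on (insert z) ?I"
      using IW WZ assms(3) by (meson inj_onI insert_ident subsetD)
    have disj: "(\<Union>a<k. W a) \<inter> insert z ` ?I = {}"
      using WZ assms(3) by blast
    have "card (\<Union>a<k. W a) + card ?I = card ((\<Union>a<k. W a) \<union> insert z ` ?I)"
      using fin finI card_image[OF inj] disj by (subst card_Un_disjoint) auto
    also have "\<dots> \<le> card (shattered_sets k (insert z Z) S)"
    proof (rule card_mono)
      show "finite (shattered_sets k (insert z Z) S)"
        using assms(1) by (simp add: finite_shattered_sets)
      have "(\<Union>a<k. W a) \<subseteq> shattered_sets k (insert z Z) S"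
        unfolding W_def by (intro UN_least shattered_sets_mono) auto
      moreover have "insert z V \<in> shattered_sets k (insert z Z) S" if V: "V \<in> ?I" for V
        unfolding shattered_sets_def
      proof (intro CollectI conjI allI impI)
        show "insert z V \<subseteq> insert z Z" using IW WZ V by blast
        fix \<sigma> assume \<sigma>: "\<forall>y\<in>insert z V. \<sigma> y < k"
        then have "V \<in> W (\<sigma> z)" using V by blast
        then show "\<exists>s\<in>S. \<forall>y\<in>insert z V. s y = \<sigma> y"
          using \<sigma> unfolding W_def shattered_sets_def by auto
      qed
      ultimately show "(\<Union>a<k. W a) \<union> insert z ` ?I \<subseteq> shattered_sets k (insert z Z) S"
        by blast
    qed
    finally show ?thesis .
  qed
  finally show ?thesis by simp
qed

text \<open>Induction on \<open>Z\<close> with a dichotomy at the new point \<open>z\<close>. If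
  every slice keeps at least the fraction \<open>\<theta>\<close> of the avoiding number, the gain
  \<open>k / (k - 1)\<close> from branching makes up for the factor
  \<open>\<theta> powr \<beta>\<close>. Otherwise some slice \<open>a\<close> is small, and the
  patterns with \<open>s z \<noteq> a\<close> keep the fraction \<open>1 - \<theta>\<close> at the
  price of one factor \<open>(1 - \<theta>) powr \<beta>\<close>.\<close>

lemma card_shattered_sets_ge:
  fixes \<theta> \<beta> :: real
  assumes "finite Z" "2 \<le> k" "0 < \<theta>" "\<theta> < 1" "0 < \<beta>" "real (k - 1) / real k \<le> \<theta> powr \<beta>"
  shows "real (avoiding_number k Z S) powr \<beta> * ((1 - \<theta>) powr \<beta>) ^ card Z
           \<le> real (card (shattered_sets k Z S))"
  using assms(1)
proof (induction Z arbitrary: S rule: finite_induct)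
  case empty
  show ?case
  proof (cases "S = {}")
    case False
    then have "avoiding_cover k {} S {\<lambda>_. 0}"
      by (simp add: avoiding_cover_def)
    from avoiding_number_le[OF this] have "avoiding_number k {} S \<le> 1" by simp
    then have "real (avoiding_number k {} S) powr \<beta> \<le> 1"
      using assms(5) by (intro powr_le1) auto
    moreover have "shattered_sets k {} S = {{}}"
      using False by (auto simp: shattered_sets_def)
    ultimately show ?thesis by simp
  qed (use assms(5) in auto)
next
  case (insert z Z)
  define q where "q = (1 - \<theta>) powr \<beta>"
  define N where "N = real (avoiding_number k (insert z Z) S)"
  have q: "0 < q" "q \<le> 1"
    using assms(3-5) by (auto simp: q_def powr_le1)
  have N: "0 \<le> N" by (simp add: N_def)
  show ?case
  proof (cases "\<forall>a<k. \<theta> * N \<le> real (avoiding_number k Z {s \<in> S. s z = a})")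
    case True
    define r where "r = (\<theta> * N) powr \<beta> * q ^ card Z"
    have r: "r \<le> real (card (shattered_sets k Z {s \<in> S. s z = a}))" if "a < k" for a
    proof -
      have "r \<le> real (avoiding_number k Z {s \<in> S. s z = a}) powr \<beta> * q ^ card Z"
        unfolding r_def using True that N q assms(3,5)
        by (intro mult_right_mono powr_mono2) auto
      then show ?thesis using insert.IH[of "{s \<in> S. s z = a}"] by (simp add: q_def)
    qed
    \<comment> \<open>The branching lemma takes a natural number, so the real bound is rounded up,
      which cardinalities allow.\<close>
    have "k * nat \<lceil>r\<rceil> \<le> (k - 1) * card (shattered_sets k (insert z Z) S)"
      using insert.hyps assms(2) r by (intro shattered_sets_branch) (auto simp: nat_le_iff ceiling_le_iff)
    then have "real k * real (nat \<lceil>r\<rceil>) \<le> real (k - 1) * real (card (shattered_sets k (insert z Z) S))"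
      by (metis of_nat_le_iff of_nat_mult)
    moreover have "real k * r \<le> real k * real (nat \<lceil>r\<rceil>)"
      by (intro mult_left_mono) (simp_all add: real_nat_ceiling_ge)
    ultimately have *: "real k * r \<le> real (k - 1) * real (card (shattered_sets k (insert z Z) S))"
      by linarith
    have "N powr \<beta> * q ^ card (insert z Z) \<le> N powr \<beta> * q ^ card Z"
      using insert.hyps q N by (simp add: mult_left_mono mult_left_le_one_le)
    also have "real (k - 1) * \<dots> \<le> (real k * \<theta> powr \<beta>) * (N powr \<beta> * q ^ card Z)"
      using assms(2,6) q by (intro mult_right_mono) (auto simp: field_simps)
    also have "\<dots> = real k * r"
      using N assms(3) by (simp add: r_def powr_mult)
    also note *
    finally show ?thesis
      using assms(2) by (simp add: N_def q_def)
  next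
    case False
    then obtain a where a: "a < k" "real (avoiding_number k Z {s \<in> S. s z = a}) < \<theta> * N"
      by (auto simp: not_le)
    \<comment> \<open>On the slice \<open>s z = a\<close> the colour \<open>b\<close> never occurs
      at \<open>z\<close>, so covers of this slice extend to \<open>z\<close> by the value
      \<open>b\<close>.\<close>
    obtain b where b: "b < k" "b \<noteq> a"
      using assms(2) that[of "if a = 0 then 1 else 0"] by (auto split: if_splits)
    let ?S = "{s \<in> S. s z \<noteq> a}"
    have "S = {s \<in> S. s z = a} \<union> ?S" by blast
    then have "avoiding_number k (insert z Z) S \<le>
        avoiding_number k (insert z Z) {s \<in> S. s z = a} + avoiding_number k (insert z Z) ?S"
      using avoiding_number_Un insert.hyps assms(2) by (metis (no_types, lifting) finite_insert)
    moreover have "avoiding_number k (insert z Z) {s \<in> S. s z = a} \<le> avoiding_number k Z {s \<in> S. s z = a}"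
      using insert.hyps assms(2) b by (intro avoiding_number_insert[where a = b]) auto
    moreover have "avoiding_number k (insert z Z) ?S \<le> avoiding_number k Z ?S"
      using insert.hyps assms(2) a by (intro avoiding_number_insert[where a = a]) auto
    ultimately have "N \<le> real (avoiding_number k Z {s \<in> S. s z = a}) + real (avoiding_number k Z ?S)"
      unfolding N_def by linarith
    then have "(1 - \<theta>) * N \<le> real (avoiding_number k Z ?S)"
      using a(2) by (simp add: algebra_simps)
    then have "((1 - \<theta>) * N) powr \<beta> * q ^ card Z \<le> real (avoiding_number k Z ?S) powr \<beta> * q ^ card Z"
      using N q assms(4,5) by (intro mult_right_mono powr_mono2) auto
    also have "\<dots> \<le> real (card (shattered_sets k Z ?S))"
      using insert.IH by (simp add: q_def)
    also have "\<dots> \<le> real (card (shattered_sets k (insert z Z) S))"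
      using insert.hyps
      by (intro of_nat_mono card_mono finite_shattered_sets shattered_sets_mono) auto
    finally show ?thesis
      using insert.hyps N assms(4) by (simp add: powr_mult N_def q_def mult_ac)
  qed
qed

lemma sum_power_card_Pow:
  fixes x :: "'b :: comm_semiring_1"
  assumes "finite Z"
  shows "(\<Sum>W\<in>Pow Z. x ^ card W) = (1 + x) ^ card Z"
  using assms
proof (induction Z rule: finite_induct)
  case (insert z Z)
  have "inj_on (insert z) (Pow Z)"
    using insert.hyps by (intro inj_onI) (metis PowD insert_ident subsetD)
  moreover have "card (insert z W) = Suc (card W)" if "W \<in> Pow Z" for W
    using that insert.hyps by (metis PowD card_insert_disjoint finite_subset subsetD)
  ultimately have "(\<Sum>W\<in>insert z ` Pow Z. x ^ card W) = x * (\<Sum>W\<in>Pow Z. x ^ card W)"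
    by (simp add: sum.reindex sum_distrib_left)
  moreover have "Pow Z \<inter> insert z ` Pow Z = {}"
    using insert.hyps by auto
  ultimately show ?case
    using insert by (simp add: Pow_insert sum.union_disjoint algebra_simps)
qed simp

text \<open>There are at least \<open>\<rho> ^ card Z\<close> shattered sets for some
  \<open>\<rho> > 1\<close>. Were all of them smaller than \<open>c * card Z\<close>, the weights
  \<open>x powr (card W - c * card Z)\<close> would exceed 1, and summing them over all subsets of
  \<open>Z\<close> would bound the number of shattered sets strictly by
  \<open>\<rho> ^ card Z\<close>.\<close>

lemma linear_size_shattered_set:
  fixes r :: real
  assumes "2 \<le> k" "1 < r"
  obtains c :: real where "0 < c"
    "\<And>(Z :: 'i set) S. finite Z \<Longrightarrow> r ^ card Z \<le> real (avoiding_number k Z S) \<Longrightarrow>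
        \<exists>W\<in>shattered_sets k Z S. c * real (card Z) \<le> real (card W)"
proof -
  \<comment> \<open>The choice gives \<open>r * (1 - \<theta>) = sqrt r\<close> and
    \<open>\<theta> powr \<beta> = (k - 1) / k\<close>, so the counting bound has rate
    \<open>\<rho>\<close>. This rate is shared equally between
    \<open>1 + x \<le> sqrt \<rho>\<close> and \<open>x powr (- c) = sqrt \<rho>\<close>; the cap
    1/2 ensures \<open>x < 1\<close>.\<close>
  define \<theta> where "\<theta> = 1 - 1 / sqrt r"
  define \<beta> where "\<beta> = ln (real k / real (k - 1)) / ln (1 / \<theta>)"
  define \<rho> where "\<rho> = sqrt r powr \<beta>"
  define x where "x = min (1/2) (sqrt \<rho> - 1)"
  define c where "c = ln (sqrt \<rho>) / ln (1 / x)"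
  have \<theta>: "0 < \<theta>" "\<theta> < 1" using assms(2) by (auto simp: \<theta>_def)
  have \<beta>: "0 < \<beta>"
    using assms(1) \<theta> by (auto simp: \<beta>_def intro!: divide_pos_pos ln_gt_zero)
  have "ln (\<theta> powr \<beta>) = ln (real (k - 1) / real k)"
    using \<theta> assms(1) by (simp add: \<beta>_def ln_powr ln_div field_simps)
  then have \<theta>\<beta>: "\<theta> powr \<beta> = real (k - 1) / real k"
    using \<theta> assms(1) by (subst (asm) ln_inj_iff) auto
  have \<rho>: "1 < \<rho>" using assms(2) \<beta> by (auto simp: \<rho>_def intro: gr_one_powr)
  have x: "0 < x" "x < 1" "1 + x \<le> sqrt \<rho>" using \<rho> by (auto simp: x_def)
  have c: "0 < c" using \<rho> x by (auto simp: c_def intro!: divide_pos_pos ln_gt_zero)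
  have xc: "x powr (- c) = sqrt \<rho>"
    using x \<rho> by (simp add: c_def powr_def ln_div)
  have "\<exists>W\<in>shattered_sets k Z S. c * real (card Z) \<le> real (card W)"
    if Z: "finite Z" and N: "r ^ card Z \<le> real (avoiding_number k Z S)" for Z :: "'i set" and S
  proof (rule ccontr)
    assume "\<not> ?thesis"
    then have small: "real (card W) < c * real (card Z)" if "W \<in> shattered_sets k Z S" for W
      using that by force
    have "\<rho> ^ card Z = (r powr \<beta> * (1 - \<theta>) powr \<beta>) ^ card Z"
      using assms(2) by (simp add: \<rho>_def \<theta>_def flip: powr_mult real_sqrt_divide)
        (simp add: real_div_sqrt)
    also have "\<dots> = (r ^ card Z) powr \<beta> * ((1 - \<theta>) powr \<beta>) ^ card Z"
      using assms(2) by (simp add: power_mult_distrib powr_power powr_powr mult.commute flip: powr_realpow)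
    also have "\<dots> \<le> real (avoiding_number k Z S) powr \<beta> * ((1 - \<theta>) powr \<beta>) ^ card Z"
      using N assms(2) \<beta> by (intro mult_right_mono powr_mono2) auto
    also have "\<dots> \<le> real (card (shattered_sets k Z S))"
      using Z assms(1) \<theta> \<beta> \<theta>\<beta> by (intro card_shattered_sets_ge) auto
    finally have ge: "\<rho> ^ card Z \<le> real (card (shattered_sets k Z S))" .
    moreover have "0 < \<rho> ^ card Z" using \<rho> by simp
    ultimately have ne: "shattered_sets k Z S \<noteq> {}" by force
    have "real (card (shattered_sets k Z S)) = (\<Sum>W\<in>shattered_sets k Z S. 1)" by simp
    also have "\<dots> < (\<Sum>W\<in>shattered_sets k Z S. x powr (real (card W) - c * real (card Z)))"
    proof (rule sum_strict_mono)
      fix W assume "W \<in> shattered_sets k Z S"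
      then have "real (card W) - c * real (card Z) < 0" using small by auto
      then have "x powr 0 < x powr (real (card W) - c * real (card Z))"
        using x by (intro powr_less_mono') auto
      then show "1 < x powr (real (card W) - c * real (card Z))" using x by simp
    qed (use Z ne finite_shattered_sets in auto)
    also have "\<dots> = (\<Sum>W\<in>shattered_sets k Z S. x ^ card W) * sqrt \<rho> ^ card Z"
    proof -
      have "x powr (real (card W) - c * real (card Z)) = x ^ card W * sqrt \<rho> ^ card Z" for W :: "'i set"
      proof -
        have "x powr (real (card W) - c * real (card Z)) = x powr (real (card W) + (- c) * real (card Z))"
          by simp
        also have "\<dots> = x powr (real (card W)) * (x powr (- c)) powr (real (card Z))"
          unfolding powr_add powr_powr ..
        finally show ?thesis using x \<rho> xc by (simp add: powr_realpow)
      qed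
      then show ?thesis by (simp add: sum_distrib_right)
    qed
    also have "\<dots> \<le> (\<Sum>W\<in>Pow Z. x ^ card W) * sqrt \<rho> ^ card Z"
      using Z x \<rho> by (intro mult_right_mono sum_mono2) (auto simp: shattered_sets_def)
    also have "\<dots> \<le> sqrt \<rho> ^ card Z * sqrt \<rho> ^ card Z"
      using Z x \<rho> by (auto simp: sum_power_card_Pow intro!: mult_right_mono power_mono)
    also have "\<dots> = \<rho> ^ card Z"
      using \<rho> by (simp flip: power_mult_distrib)
    finally show False using ge by simp
  qed
  then show ?thesis using c that by blast
qed

section \<open>Dense independence and finite covers\<close>

text \<open>Times are natural numbers, so no inverse of \<open>T\<close> occurs and both choices of
  the acting semigroup are treated at once.\<close>

definition indep_times :: "'a set \<Rightarrow> ('a \<Rightarrow> 'a) \<Rightarrow> (nat \<Rightarrow> 'a set) \<Rightarrow> nat \<Rightarrow> nat set \<Rightarrow> bool" where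
  "indep_times X T A k I \<longleftrightarrow>
     (\<forall>\<sigma>. (\<forall>s\<in>I. \<sigma> s < k) \<longrightarrow> (\<exists>x\<in>X. \<forall>s\<in>I. (T ^^ s) x \<in> A (\<sigma> s)))"

text \<open>Infinitely many window lengths are asked for, not almost all: if each of them satisfies
  one of two alternatives, a single alternative holds for infinitely many.\<close>

definition densely_independent :: "'a set \<Rightarrow> ('a \<Rightarrow> 'a) \<Rightarrow> (nat \<Rightarrow> 'a set) \<Rightarrow> nat \<Rightarrow> bool" where
  "densely_independent X T A k \<longleftrightarrow>
     (\<exists>c::real > 0. \<exists>\<^sub>F n in sequentially.
        \<exists>I \<subseteq> {..<n}. indep_times X T A k I \<and> c * real n \<le> real (card I))"

lemma indep_times_subset:
  assumes "indep_times X T A k I" "I' \<subseteq> I" "0 < k"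
  shows "indep_times X T A k I'"
  unfolding indep_times_def
proof (intro allI impI)
  fix \<sigma> assume "\<forall>s\<in>I'. \<sigma> s < k"
  then have "\<forall>s\<in>I. (if s \<in> I' then \<sigma> s else 0) < k" using assms(3) by simp
  then obtain x where "x \<in> X" "\<forall>s\<in>I. (T ^^ s) x \<in> A (if s \<in> I' then \<sigma> s else 0)"
    using assms(1) unfolding indep_times_def
    by (elim allE[where x = "\<lambda>s. if s \<in> I' then \<sigma> s else 0"]) blast
  then show "\<exists>x\<in>X. \<forall>s\<in>I'. (T ^^ s) x \<in> A (\<sigma> s)" using assms(2) by fastforce
qed

lemma funpow_mem: "T ` X \<subseteq> X \<Longrightarrow> x \<in> X \<Longrightarrow> (T ^^ n) x \<in> X"
  by (induction n) auto

text \<open>If \<open>x\<close> realises the translated pattern along the part of \<open>I\<close>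
  from \<open>p\<close> on, then \<open>(T ^^ p) x\<close> realises the given one.\<close>

lemma indep_times_shift:
  assumes "indep_times X T A k I" "0 < k" "T ` X \<subseteq> X"
  shows "indep_times X T A k {s. s + p \<in> I}"
  unfolding indep_times_def
proof (intro allI impI)
  fix \<sigma> assume \<sigma>: "\<forall>s\<in>{s. s + p \<in> I}. \<sigma> s < k"
  have "indep_times X T A k (I \<inter> {p..})"
    using assms(1) by (rule indep_times_subset) (use assms(2) in auto)
  moreover have "\<forall>s\<in>I \<inter> {p..}. \<sigma> (s - p) < k" using \<sigma> by auto
  ultimately obtain x where x: "x \<in> X" "\<forall>s\<in>I \<inter> {p..}. (T ^^ s) x \<in> A (\<sigma> (s - p))"
    unfolding indep_times_def by (elim allE[where x = "\<lambda>s. \<sigma> (s - p)"]) blast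
  have "(T ^^ s) ((T ^^ p) x) \<in> A (\<sigma> s)" if "s + p \<in> I" for s
    using x(2)[rule_format, of "s + p"] that by (simp add: funpow_add)
  then show "\<exists>x\<in>X. \<forall>s\<in>{s. s + p \<in> I}. (T ^^ s) x \<in> A (\<sigma> s)"
    using funpow_mem[OF assms(3) x(1)] by blast
qed

text \<open>The reindexing \<open>c\<close> may repeat or omit members. This serves to enlarge sets,
  to drop duplicates, and to treat tuples with repeated points.\<close>

lemma indep_times_comp:
  assumes "indep_times X T A k I" "\<And>i. i < l \<Longrightarrow> c i < k \<and> A (c i) \<subseteq> B i"
  shows "indep_times X T B l I"
  unfolding indep_times_def
proof (intro allI impI)
  fix \<sigma> assume \<sigma>: "\<forall>s\<in>I. \<sigma> s < l"
  then have "\<forall>s\<in>I. c (\<sigma> s) < k" using assms(2) by blast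
  then obtain x where "x \<in> X" "\<forall>s\<in>I. (T ^^ s) x \<in> A (c (\<sigma> s))"
    using assms(1) unfolding indep_times_def by (elim allE[where x = "\<lambda>s. c (\<sigma> s)"]) blast
  then show "\<exists>x\<in>X. \<forall>s\<in>I. (T ^^ s) x \<in> B (\<sigma> s)" using assms(2) \<sigma> by blast
qed

lemma densely_independent_comp:
  assumes "densely_independent X T A k" "\<And>i. i < l \<Longrightarrow> c i < k \<and> A (c i) \<subseteq> B i"
  shows "densely_independent X T B l"
proof -
  have "indep_times X T B l I" if "indep_times X T A k I" for I
    using that assms(2) by (rule indep_times_comp)
  then show ?thesis
    using assms(1) unfolding densely_independent_def
    by (blast intro: frequently_elim1)
qed

lemma densely_independent_mono:
  assumes "densely_independent X T A k" "\<And>i. i < k \<Longrightarrow> A i \<subseteq> B i"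
  shows "densely_independent X T B k"
  using assms(1)
proof (rule densely_independent_comp)
  show "id i < k \<and> A (id i) \<subseteq> B i" if "i < k" for i
    using that assms(2) by simp
qed

text \<open>The patterns along \<open>I\<close> that are realised by points; values \<open>\<ge> k\<close> impose no condition.\<close>
definition patterns :: "'a set \<Rightarrow> ('a \<Rightarrow> 'a) \<Rightarrow> (nat \<Rightarrow> 'a set) \<Rightarrow> nat \<Rightarrow> nat set \<Rightarrow> (nat \<Rightarrow> nat) set" where
  "patterns X T A k I = {s. \<exists>x\<in>X. \<forall>z\<in>I. s z < k \<longrightarrow> (T ^^ z) x \<in> A (s z)}"

section \<open>Splitting one member of a densely independent tuple\<close>

lemma indep_times_of_shattered:
  assumes "W \<in> shattered_sets k I (patterns X T A k I)"
  shows "indep_times X T A k W"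
  unfolding indep_times_def
proof (intro allI impI)
  fix \<sigma> assume \<sigma>: "\<forall>s\<in>W. \<sigma> s < k"
  then obtain s where s: "s \<in> patterns X T A k I" "\<forall>z\<in>W. s z = \<sigma> z"
    using assms unfolding shattered_sets_def by blast
  have "W \<subseteq> I" using assms by (simp add: shattered_sets_def)
  obtain x where "x \<in> X" "\<forall>z\<in>I. s z < k \<longrightarrow> (T ^^ z) x \<in> A (s z)"
    using s(1) unfolding patterns_def by blast
  then show "\<exists>x\<in>X. \<forall>z\<in>W. (T ^^ z) x \<in> A (\<sigma> z)"
    using s(2) \<sigma> \<open>W \<subseteq> I\<close> by (metis subsetD)
qed

text \<open>A union bound: each \<open>f\<close> accounts for only \<open>(k - 1) ^ card Z\<close>
  of the \<open>k ^ card Z\<close> patterns.\<close>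

lemma avoiding_cover_full:
  assumes "finite Z" "2 \<le> k" "avoiding_cover k Z {\<sigma>. \<forall>z\<in>Z. \<sigma> z < k} F"
  shows "k ^ card Z \<le> card F * (k - 1) ^ card Z"
proof -
  have fin: "finite F" and Fk: "\<And>f z. f \<in> F \<Longrightarrow> z \<in> Z \<Longrightarrow> f z < k"
    using assms(3) by (auto simp: avoiding_cover_def)
  have "(Z \<rightarrow>\<^sub>E {..<k}) \<subseteq> (\<Union>f\<in>F. \<Pi>\<^sub>E z\<in>Z. {..<k} - {f z})"
  proof
    fix \<sigma> assume \<sigma>: "\<sigma> \<in> Z \<rightarrow>\<^sub>E {..<k}"
    then have "\<forall>z\<in>Z. \<sigma> z < k" by auto
    then obtain f where "f \<in> F" "\<forall>z\<in>Z. \<sigma> z \<noteq> f z"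
      using assms(3) unfolding avoiding_cover_def by blast
    with \<sigma> show "\<sigma> \<in> (\<Union>f\<in>F. \<Pi>\<^sub>E z\<in>Z. {..<k} - {f z})"
      by (auto simp: PiE_iff)
  qed
  then have "card (Z \<rightarrow>\<^sub>E {..<k}) \<le> card (\<Union>f\<in>F. \<Pi>\<^sub>E z\<in>Z. {..<k} - {f z})"
    using fin assms(1) by (intro card_mono) (auto intro!: finite_PiE)
  also have "\<dots> \<le> (\<Sum>f\<in>F. card (\<Pi>\<^sub>E z\<in>Z. {..<k} - {f z}))"
    using fin by (rule card_UN_le)
  also have "\<dots> = (\<Sum>f\<in>F. (k - 1) ^ card Z)"
    using assms(1) Fk by (intro sum.cong) (auto simp: card_PiE)
  finally show ?thesis using assms(1) by (simp add: card_PiE)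
qed

text \<open>Covers for the two parts combine, pair by pair, into a cover of all patterns along
  \<open>I\<close>; the bound for the full set of patterns then applies.\<close>

lemma avoiding_number_split:
  assumes "finite I" "2 \<le> k" "i < k" "A i \<subseteq> B \<union> C" "indep_times X T A k I"
  shows "k ^ card I \<le> avoiding_number k I (patterns X T (A(i := B)) k I)
           * avoiding_number k I (patterns X T (A(i := C)) k I) * (k - 1) ^ card I"
proof -
  obtain F where F: "avoiding_cover k I (patterns X T (A(i := B)) k I) F"
    "card F = avoiding_number k I (patterns X T (A(i := B)) k I)"
    using avoiding_number_attained[OF assms(1,2)] .
  obtain G where G: "avoiding_cover k I (patterns X T (A(i := C)) k I) G"
    "card G = avoiding_number k I (patterns X T (A(i := C)) k I)"
    using avoiding_number_attained[OF assms(1,2)] .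
  \<comment> \<open>The combined function follows \<open>f\<close>, except where \<open>f\<close>
    forbids the split colour \<open>i\<close>; there \<open>g\<close> decides.\<close>
  define comb where "comb = (\<lambda>(f, g) (z::nat). if f z = i then g z else (f z :: nat))"
  have "avoiding_cover k I {\<sigma>. \<forall>z\<in>I. \<sigma> z < k} (comb ` (F \<times> G))"
    unfolding avoiding_cover_def
  proof (intro conjI ballI)
    show "finite (comb ` (F \<times> G))" using F(1) G(1) by (simp add: avoiding_cover_def)
  next
    fix h z assume "h \<in> comb ` (F \<times> G)" "z \<in> I"
    then show "h z < k"
      using F(1) G(1) unfolding avoiding_cover_def comb_def by auto
  next
    fix \<sigma> assume "\<sigma> \<in> {\<sigma>. \<forall>z\<in>I. \<sigma> z < k}"
    then have \<sigma>: "\<forall>z\<in>I. \<sigma> z < k" by simp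
    then obtain x where x: "x \<in> X" "\<forall>z\<in>I. (T ^^ z) x \<in> A (\<sigma> z)"
      using assms(5) unfolding indep_times_def by blast
    \<comment> \<open>Where the colour is \<open>i\<close> but the orbit misses \<open>B\<close>,
      the pattern is left undetermined by the value \<open>k\<close>, so \<open>x\<close> realises
      it for \<open>A(i := B)\<close>; likewise for \<open>C\<close>. As \<open>A i\<close> lies in
      \<open>B \<union> C\<close>, the colour \<open>i\<close> survives in at least one of the
      two.\<close>
    define sB where "sB z = (if \<sigma> z = i \<and> (T ^^ z) x \<notin> B then k else \<sigma> z)" for z
    define sC where "sC z = (if \<sigma> z = i \<and> (T ^^ z) x \<notin> C then k else \<sigma> z)" for z
    have "sB \<in> patterns X T (A(i := B)) k I" "sC \<in> patterns X T (A(i := C)) k I"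
      unfolding patterns_def using x by (auto simp: sB_def sC_def intro!: bexI[of _ x])
    then have "\<exists>f\<in>F. \<forall>z\<in>I. sB z \<noteq> f z" "\<exists>g\<in>G. \<forall>z\<in>I. sC z \<noteq> g z"
      using F(1) G(1) by (simp_all add: avoiding_cover_def)
    then obtain f g where fg: "f \<in> F" "\<forall>z\<in>I. sB z \<noteq> f z" "g \<in> G" "\<forall>z\<in>I. sC z \<noteq> g z"
      by (elim bexE)
    have "\<sigma> z \<noteq> comb (f, g) z" if z: "z \<in> I" for z
    proof
      assume eq: "\<sigma> z = comb (f, g) z"
      have "sB z \<noteq> f z" "sC z \<noteq> g z" using fg z by auto
      with eq have "\<sigma> z = i" "(T ^^ z) x \<notin> B" "(T ^^ z) x \<notin> C"
        by (auto simp: comb_def sB_def sC_def split: if_splits)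
      then show False using x(2) z assms(4) by fastforce
    qed
    then show "\<exists>h\<in>comb ` (F \<times> G). \<forall>z\<in>I. \<sigma> z \<noteq> h z" using fg(1,3) by blast
  qed
  then have "k ^ card I \<le> card (comb ` (F \<times> G)) * (k - 1) ^ card I"
    using assms(1,2) by (intro avoiding_cover_full)
  also have "card (comb ` (F \<times> G)) \<le> card (F \<times> G)"
    using F(1) G(1) by (intro card_image_le) (simp add: avoiding_cover_def)
  finally show ?thesis using F(2) G(2) by (simp add: card_cartesian_product)
qed

lemma densely_independent_split:
  assumes "densely_independent X T A k" "2 \<le> k" "i < k" "A i \<subseteq> B \<union> C"
  shows "densely_independent X T (A(i := B)) k \<or> densely_independent X T (A(i := C)) k"
proof -
  \<comment> \<open>\<open>r * r\<close> is the growth rate \<open>k / (k - 1)\<close> forced on the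
    product of the two avoiding numbers, so one of them is at least
    \<open>r ^ card I\<close>.\<close>
  define r where "r = sqrt (real k / real (k - 1))"
  have "1 < r" using assms(2) by (simp add: r_def)
  then obtain c where c: "0 < c" "\<And>(Z :: nat set) S. finite Z \<Longrightarrow>
      r ^ card Z \<le> real (avoiding_number k Z S) \<Longrightarrow>
      \<exists>W\<in>shattered_sets k Z S. c * real (card Z) \<le> real (card W)"
    using linear_size_shattered_set[OF assms(2)] by metis
  obtain d where d: "0 < d" "\<exists>\<^sub>F n in sequentially.
        \<exists>I \<subseteq> {..<n}. indep_times X T A k I \<and> d * real n \<le> real (card I)"
    using assms(1) unfolding densely_independent_def by blast
  let ?P = "\<lambda>B n. \<exists>W \<subseteq> {..<n}. indep_times X T (A(i := B)) k W \<and> c * d * real n \<le> real (card W)"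
  have "\<exists>\<^sub>F n in sequentially. ?P B n \<or> ?P C n"
    using d(2)
  proof (rule frequently_elim1)
    fix n assume "\<exists>I \<subseteq> {..<n}. indep_times X T A k I \<and> d * real n \<le> real (card I)"
    then obtain I where I: "I \<subseteq> {..<n}" "indep_times X T A k I" "d * real n \<le> real (card I)"
      by blast
    have fin: "finite I" using I(1) finite_subset by blast
    define NB where "NB = avoiding_number k I (patterns X T (A(i := B)) k I)"
    define NC where "NC = avoiding_number k I (patterns X T (A(i := C)) k I)"
    have large: "?P D n"
      if "r ^ card I \<le> real (avoiding_number k I (patterns X T (A(i := D)) k I))" for D
    proof -
      obtain W where W: "W \<in> shattered_sets k I (patterns X T (A(i := D)) k I)"
        "c * real (card I) \<le> real (card W)"
        using c(2)[OF fin \<open>r ^ card I \<le> _\<close>] by blast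
      have "c * (d * real n) \<le> c * real (card I)"
        using I(3) c(1) by (intro mult_left_mono) auto
      moreover have "W \<subseteq> {..<n}" using W(1) I(1) by (auto simp: shattered_sets_def)
      ultimately show ?thesis
        using W indep_times_of_shattered[OF W(1)] by (auto simp: mult.assoc)
    qed
    have "k ^ card I \<le> NB * NC * (k - 1) ^ card I"
      unfolding NB_def NC_def using fin assms(2-4) I(2) by (rule avoiding_number_split)
    then have "real k ^ card I \<le> real NB * real NC * real (k - 1) ^ card I"
      by (metis of_nat_le_iff of_nat_mult of_nat_power)
    then have "(real k / real (k - 1)) ^ card I \<le> real NB * real NC"
      using assms(2) by (simp add: power_divide divide_le_eq)
    then have *: "r ^ card I * r ^ card I \<le> real NB * real NC"
      using assms(2) by (simp add: r_def flip: power_mult_distrib)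
    have "r ^ card I \<le> real NB \<or> r ^ card I \<le> real NC"
    proof (rule ccontr)
      assume "\<not> ?thesis"
      then have "real NB * real NC < r ^ card I * r ^ card I"
        by (intro mult_strict_mono') auto
      with * show False by simp
    qed
    then show "?P B n \<or> ?P C n" using large unfolding NB_def NC_def by blast
  qed
  then consider "\<exists>\<^sub>F n in sequentially. ?P B n" | "\<exists>\<^sub>F n in sequentially. ?P C n"
    by (auto simp: frequently_disj_iff)
  moreover have "0 < c * d" using c(1) d(1) by simp
  ultimately show ?thesis unfolding densely_independent_def by cases blast+
qed

text \<open>Repeated splitting into \<open>A i \<inter> C\<close> and the part covered by the rest.
  The empty cover is impossible, since the constant pattern \<open>i\<close> is realised at some
  time of a nonempty \<open>I\<close>; applied to it, the lemma shows that members of such tuples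
  are nonempty.\<close>

lemma densely_independent_finite_cover:
  assumes "finite \<C>" "densely_independent X T A k" "2 \<le> k" "i < k" "A i \<subseteq> \<Union>\<C>"
  shows "\<exists>C\<in>\<C>. densely_independent X T (A(i := A i \<inter> C)) k"
  using assms(1,2,5)
proof (induction \<C> arbitrary: A rule: finite_induct)
  case empty
  obtain c where c: "0 < c" "\<exists>\<^sub>F n in sequentially.
        \<exists>I \<subseteq> {..<n}. indep_times X T A k I \<and> c * real n \<le> real (card I)"
    using empty(1) unfolding densely_independent_def by blast
  obtain n I where n: "0 < n" "indep_times X T A k I" "c * real n \<le> real (card I)"
    using frequently_eventually_frequently[OF c(2) eventually_gt_at_top[of 0]]
    by (auto dest!: frequently_ex)
  have "0 < c * real n" using c(1) n(1) by simp
  then obtain s where "s \<in> I" using n(3) by fastforce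
  moreover have "\<forall>s\<in>I. (\<lambda>_. i) s < k" using assms(4) by simp
  then obtain x where "\<forall>s\<in>I. (T ^^ s) x \<in> A i"
    using n(2) unfolding indep_times_def by (elim allE[where x = "\<lambda>_. i"]) blast
  ultimately show ?case using empty(2) by auto
next
  case (insert C \<C>)
  have "A i \<subseteq> (A i \<inter> C) \<union> (A i \<inter> \<Union>\<C>)" using insert.prems(2) by auto
  from densely_independent_split[OF insert.prems(1) assms(3,4) this] show ?case
  proof
    assume "densely_independent X T (A(i := A i \<inter> \<Union>\<C>)) k"
    from insert.IH[OF this] obtain D where D: "D \<in> \<C>"
      "densely_independent X T ((A(i := A i \<inter> \<Union>\<C>))(i := (A(i := A i \<inter> \<Union>\<C>)) i \<inter> D)) k"
      by (metis fun_upd_same inf.cobounded2)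
    have "densely_independent X T (A(i := A i \<inter> D)) k"
      using D(2) by (rule densely_independent_mono) auto
    then show ?thesis using D(1) by blast
  qed (rule bexI[of _ C], assumption, simp)
qed

text \<open>Total boundedness gives a finite cover of \<open>X\<close> by closed balls of radius
  \<open>\<epsilon> / 2\<close>; the members are cut down to such balls one after the other.\<close>

lemma densely_independent_small:
  fixes X :: "'a::metric_space set"
  assumes "compact X" "2 \<le> k" "0 < \<epsilon>" "densely_independent X T A k"
    "\<And>j. j < k \<Longrightarrow> closed (A j) \<and> A j \<subseteq> X"
  obtains B where "densely_independent X T B k"
    "\<forall>j<k. closed (B j) \<and> B j \<subseteq> A j" "\<forall>j<k. \<forall>x\<in>B j. \<forall>y\<in>B j. dist x y \<le> \<epsilon>"
proof -
  obtain K where K: "finite K" "X \<subseteq> (\<Union>x\<in>K. ball x (\<epsilon> / 2))"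
    using assms(1,3) unfolding compact_eq_totally_bounded by (meson half_gt_zero)
  let ?\<C> = "(\<lambda>x. cball x (\<epsilon> / 2)) ` K"
  have cover: "X \<subseteq> \<Union>?\<C>" using K(2) ball_subset_cball by (force simp: subset_iff)
  have "\<exists>B. densely_independent X T B k \<and> (\<forall>j<k. closed (B j) \<and> B j \<subseteq> A j) \<and>
      (\<forall>j<l. \<forall>x\<in>B j. \<forall>y\<in>B j. dist x y \<le> \<epsilon>)" if "l \<le> k" for l
    using that
  proof (induction l)
    case 0
    then show ?case using assms(4,5) by blast
  next
    case (Suc l)
    then obtain B where B: "densely_independent X T B k" "\<forall>j<k. closed (B j) \<and> B j \<subseteq> A j"
      "\<forall>j<l. \<forall>x\<in>B j. \<forall>y\<in>B j. dist x y \<le> \<epsilon>" by auto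
    have "B l \<subseteq> \<Union>?\<C>" using B(2) Suc.prems assms(5)[of l] cover by (meson Suc_le_lessD subset_trans)
    then obtain C where C: "C \<in> ?\<C>" "densely_independent X T (B(l := B l \<inter> C)) k"
      using densely_independent_finite_cover[of ?\<C> X T B k l] K(1) B(1) assms(2) Suc.prems by auto
    have "dist x y \<le> \<epsilon>" if "x \<in> C" "y \<in> C" for x y
    proof -
      obtain z where "C = cball z (\<epsilon> / 2)" using C(1) by blast
      then have "dist z x \<le> \<epsilon> / 2" "dist z y \<le> \<epsilon> / 2" using that by auto
      then show ?thesis using dist_triangle3[of x y z] by linarith
    qed
    then have "\<forall>j<Suc l. \<forall>x\<in>(B(l := B l \<inter> C)) j. \<forall>y\<in>(B(l := B l \<inter> C)) j. dist x y \<le> \<epsilon>"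
      using B(3) by (auto simp: less_Suc_eq)
    moreover have "\<forall>j<k. closed ((B(l := B l \<inter> C)) j) \<and> (B(l := B l \<inter> C)) j \<subseteq> A j"
      using B(2) C(1) by auto
    ultimately show ?case using C(2) by blast
  qed
  from this[of k] that show ?thesis by blast
qed

section \<open>Realising densities\<close>

text \<open>Jumping over blocks of density less than \<open>a\<close> from \<open>p\<close> onwards, one reaches \<open>N\<close> up to an error
  of at most \<open>L\<close>.\<close>
lemma card_le_of_sparse_blocks:
  fixes a :: real and I :: "nat set"
  assumes "0 \<le> a" "\<And>p. \<exists>l\<le>L. 0 < l \<and> real (card (I \<inter> {p..<p + l})) < a * real l"
  shows "real (card (I \<inter> {p..<N})) \<le> a * real (N - p) + real L"
proof (induction "N - p" arbitrary: p rule: less_induct)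
  case less
  show ?case
  proof (cases "p + L < N")
    case True
    obtain l where l: "l \<le> L" "0 < l" "real (card (I \<inter> {p..<p + l})) < a * real l"
      using assms(2) by blast
    have "I \<inter> {p..<N} = (I \<inter> {p..<p + l}) \<union> (I \<inter> {p + l..<N})"
      using True l(1) by auto
    then have "card (I \<inter> {p..<N}) \<le> card (I \<inter> {p..<p + l}) + card (I \<inter> {p + l..<N})"
      by (metis card_Un_le)
    moreover have "real (card (I \<inter> {p + l..<N})) \<le> a * real (N - (p + l)) + real L"
      using l(2) True by (intro less) auto
    moreover have "a * real l + a * real (N - (p + l)) = a * real (N - p)"
      using True l(1) by (simp add: of_nat_diff algebra_simps)
    ultimately show ?thesis using l(3) by linarith
  next
    case False
    have "card (I \<inter> {p..<N}) \<le> card {p..<N}" by (rule card_mono) auto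
    also have "\<dots> \<le> L" using False by simp
    finally show ?thesis using assms(1) by (simp add: add_increasing)
  qed
qed

text \<open>A compactness argument as in Konig's lemma for the binary tree, with ASCII name Koenig:
  a prefix occurring for infinitely many \<open>L\<close> has an extension by one position that also
  does.\<close>

lemma prefix_limit:
  fixes I :: "nat \<Rightarrow> nat set"
  obtains J where "\<And>n. \<exists>\<^sub>F L in sequentially. I L \<inter> {..<n} = J \<inter> {..<n}"
proof -
  let ?P = "\<lambda>n A. \<exists>\<^sub>F L in sequentially. I L \<inter> {..<n} = A"
  have "\<exists>f. \<forall>n. ?P n (f n) \<and> f (Suc n) \<inter> {..<n} = f n"
  proof (rule dependent_nat_choice)
    show "\<exists>A. ?P 0 A" by (rule exI[of _ "{}"]) simp
  next
    fix A n assume A: "?P n A"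
    have sub: "A \<subseteq> {..<n}" using A by (auto dest!: frequently_ex)
    have "\<exists>\<^sub>F L in sequentially. I L \<inter> {..<Suc n} = A \<or> I L \<inter> {..<Suc n} = insert n A"
      using A by (rule frequently_elim1) (auto simp: lessThan_Suc)
    then have "?P (Suc n) A \<or> ?P (Suc n) (insert n A)"
      by (simp add: frequently_disj_iff)
    moreover have "A \<inter> {..<n} = A" "insert n A \<inter> {..<n} = A" using sub by auto
    ultimately show "\<exists>B. ?P (Suc n) B \<and> B \<inter> {..<n} = A" by blast
  qed
  then obtain f where f: "\<And>n. ?P n (f n)" "\<And>n. f (Suc n) \<inter> {..<n} = f n" by blast
  have f_le: "f m \<inter> {..<n} = f n" if "n \<le> m" for n m
    using that
  proof (induction m rule: dec_induct)
    case base
    then show ?case using f(2)[of n] by auto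
  next
    case (step m)
    have "f (Suc m) \<inter> {..<n} = (f (Suc m) \<inter> {..<m}) \<inter> {..<n}" using step.hyps by auto
    then show ?case using f(2)[of m] step.IH by simp
  qed
  have "(\<Union>m. f m) \<inter> {..<n} = f n" for n
  proof (intro equalityI subsetI)
    fix x assume "x \<in> (\<Union>m. f m) \<inter> {..<n}"
    then obtain m where "x \<in> f m" "x < n" by auto
    then show "x \<in> f n"
      using f_le[of n m] f_le[of m n] by (cases "n \<le> m") auto
  next
    fix x assume "x \<in> f n"
    then show "x \<in> (\<Union>m. f m) \<inter> {..<n}" using f_le[of n n] by auto
  qed
  then show ?thesis using that[of "\<Union>m. f m"] f(1) by simp
qed

text \<open>A set attaining the supremum \<open>d\<close> of the upper densities of \<open>P\<close>: from finite sets of density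
  close to \<open>d\<close> one cuts out pieces all of whose initial segments have density close to \<open>d\<close>.\<close>
lemma density_realization:
  fixes P :: "nat set \<Rightarrow> bool" and c :: real
  assumes sub: "\<And>I I'. P I \<Longrightarrow> I' \<subseteq> I \<Longrightarrow> P I'"
    and shift: "\<And>I p. P I \<Longrightarrow> P {s. s + p \<in> I}"
    and "0 < c" "\<exists>\<^sub>F n in sequentially. \<exists>I\<subseteq>{..<n}. P I \<and> c * real n \<le> real (card I)"
  obtains J d where "\<And>n. P (J \<inter> {..<n})" "0 < d"
    "(\<lambda>n. real (card (J \<inter> {..<n})) / real n) \<longlonglongrightarrow> d"
proof -
  define Q where "Q a \<longleftrightarrow> (\<exists>\<^sub>F n in sequentially. \<exists>I\<subseteq>{..<n}. P I \<and> a * real n \<le> real (card I))" for a :: real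
  have Q1: "a \<le> 1" if Qa: "Q a" for a
  proof -
    obtain n where n: "0 < n" "\<exists>I\<subseteq>{..<n}. P I \<and> a * real n \<le> real (card I)"
      using frequently_eventually_frequently[OF Qa[unfolded Q_def] eventually_gt_at_top[of 0]]
      by (auto dest!: frequently_ex)
    then obtain I where I: "I \<subseteq> {..<n}" "a * real n \<le> real (card I)" by blast
    have "card I \<le> n" using card_mono[OF _ I(1)] by simp
    then have "a * real n \<le> 1 * real n" using I(2) by simp
    then show ?thesis using n(1) by (simp only: mult_le_cancel_right_pos of_nat_0_less_iff)
  qed
  define d where "d = Sup (Collect Q)"
  have bdd: "bdd_above (Collect Q)" using Q1 by (intro bdd_aboveI[of _ 1]) auto
  have Qc: "Q c" using assms(4) by (simp add: Q_def)
  have cd: "c \<le> d" unfolding d_def using Qc bdd by (intro cSup_upper) auto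
  have Qd: "Q a" if ad: "a < d" for a
  proof -
    obtain b where b: "Q b" "a < b"
      using less_cSup_iff[of "Collect Q" a] Qc bdd ad unfolding d_def by auto
    have "a * real n \<le> real m" if "b * real n \<le> real m" for n m
      using that b(2) mult_right_mono[of a b "real n"] by linarith
    then show ?thesis using b(1) unfolding Q_def by (elim frequently_elim1) blast
  qed
  \<comment> \<open>Take a set of density at least \<open>d - e / 2\<close> in a long window. If
    every translate of it had a sparse initial block of length at most \<open>L\<close>, jumping
    over these blocks would bound its density by about \<open>d - e\<close>.\<close>
  have prefix: "\<exists>I. P I \<and> (\<forall>l\<le>L. (d - e) * real l \<le> real (card (I \<inter> {..<l})))" if e: "0 < e" "e < d" for e L
  proof (rule ccontr)
    assume no: "\<not> ?thesis"
    have "\<forall>\<^sub>F N in sequentially. real L + 1 \<le> e / 2 * real N"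
      using e by (intro eventually_sequentiallyI[of "nat \<lceil>(real L + 1) * 2 / e\<rceil>"])
        (simp add: field_simps nat_le_iff ceiling_le_iff)
    moreover have "Q (d - e / 2)" using e by (intro Qd) simp
    ultimately have "\<exists>\<^sub>F N in sequentially.
        (\<exists>I\<subseteq>{..<N}. P I \<and> (d - e / 2) * real N \<le> real (card I)) \<and> real L + 1 \<le> e / 2 * real N"
      unfolding Q_def by (rule frequently_eventually_frequently[rotated])
    then obtain N I where N: "real L + 1 \<le> e / 2 * real N" "I \<subseteq> {..<N}" "P I"
      "(d - e / 2) * real N \<le> real (card I)"
      by (blast dest: frequently_ex)
    have "\<exists>l\<le>L. 0 < l \<and> real (card (I \<inter> {p..<p + l})) < (d - e) * real l" for p
    proof -
      have "\<not> (\<forall>l\<le>L. (d - e) * real l \<le> real (card ({s. s + p \<in> I} \<inter> {..<l})))"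
        using no shift[OF N(3), of p] by blast
      then obtain l where l: "l \<le> L" "real (card ({s. s + p \<in> I} \<inter> {..<l})) < (d - e) * real l"
        by (auto simp: not_le)
      have "(\<lambda>s. s + p) ` ({s. s + p \<in> I} \<inter> {..<l}) = I \<inter> {p..<p + l}"
        (is "?l = ?r")
      proof (intro equalityI subsetI)
        fix t assume "t \<in> ?r"
        then show "t \<in> ?l" by (intro image_eqI[of _ _ "t - p"]) auto
      qed auto
      then have "card (I \<inter> {p..<p + l}) = card ({s. s + p \<in> I} \<inter> {..<l})"
        using card_image[of "\<lambda>s. s + p" "{s. s + p \<in> I} \<inter> {..<l}"] by (simp add: inj_on_def)
      moreover have "0 < l" using l(2) by (cases l) auto
      ultimately show ?thesis using l by auto
    qed
    then have "real (card (I \<inter> {0..<N})) \<le> (d - e) * real (N - 0) + real L"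
      using e by (intro card_le_of_sparse_blocks) auto
    moreover have "I \<inter> {0..<N} = I" using N(2) by auto
    ultimately have "real (card I) \<le> (d - e) * real N + real L" by simp
    then show False using N(1,4) by (simp add: algebra_simps)
  qed
  have d: "0 < d" using cd assms(3) by linarith
  \<comment> \<open>The error \<open>d / (L + 2)\<close> lies strictly between 0 and
    \<open>d\<close>, as required above, and tends to 0 with growing \<open>L\<close>.\<close>
  have "\<exists>I. P I \<and> (\<forall>l\<le>L. (d - d / (real L + 2)) * real l \<le> real (card (I \<inter> {..<l})))" for L
    using d by (intro prefix) (auto simp: field_simps add_pos_nonneg)
  then obtain I where I: "\<And>L. P (I L)"
    "\<And>L l. l \<le> L \<Longrightarrow> (d - d / (real L + 2)) * real l \<le> real (card (I L \<inter> {..<l}))"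
    by metis
  obtain J where J: "\<And>n. \<exists>\<^sub>F L in sequentially. I L \<inter> {..<n} = J \<inter> {..<n}"
    using prefix_limit[of I] by blast
  have PJ: "P (J \<inter> {..<n})" for n
  proof -
    obtain L where "I L \<inter> {..<n} = J \<inter> {..<n}" using frequently_ex[OF J] by blast
    then show ?thesis using sub[OF I(1)[of L], of "J \<inter> {..<n}"] by blast
  qed
  have lower: "d * real n \<le> real (card (J \<inter> {..<n}))" for n
  proof (rule field_le_epsilon)
    fix e :: real assume "0 < e"
    then have "\<forall>\<^sub>F L in sequentially. d / (real L + 2) * real n < e"
      by (intro eventually_sequentiallyI[of "nat \<lceil>d * real n / e\<rceil>"])
        (simp add: field_simps nat_le_iff ceiling_le_iff)
    then have "\<forall>\<^sub>F L in sequentially. n \<le> L \<and> d / (real L + 2) * real n < e"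
      using eventually_ge_at_top[of n] by eventually_elim simp
    from frequently_eventually_frequently[OF J[of n] this]
    obtain L where L: "I L \<inter> {..<n} = J \<inter> {..<n}" "n \<le> L" "d / (real L + 2) * real n < e"
      by (auto dest!: frequently_ex)
    have "d * real n - d / (real L + 2) * real n \<le> real (card (J \<inter> {..<n}))"
      using I(2)[OF L(2)] L(1) by (simp add: algebra_simps)
    with L(3) show "d * real n \<le> real (card (J \<inter> {..<n})) + e" by linarith
  qed
  have "(\<lambda>n. real (card (J \<inter> {..<n})) / real n) \<longlonglongrightarrow> d"
  proof (rule order_tendstoI)
    fix a assume "a < d"
    show "\<forall>\<^sub>F n in sequentially. a < real (card (J \<inter> {..<n})) / real n"
      using eventually_gt_at_top[of 0]
    proof eventually_elim
      fix n :: nat assume "0 < n"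
      then have "d \<le> real (card (J \<inter> {..<n})) / real n"
        using lower[of n] by (simp add: field_simps)
      with \<open>a < d\<close> show "a < real (card (J \<inter> {..<n})) / real n" by linarith
    qed
  next
    fix a assume "d < a"
    \<comment> \<open>Beyond the supremum, \<open>Q a\<close> fails; since every prefix of
      \<open>J\<close> satisfies \<open>P\<close>, prefixes of density at least \<open>a\<close>
      occur only finitely often.\<close>
    then have "\<not> Q a" using bdd cSup_upper[of a "Collect Q"] unfolding d_def by auto
    then have "\<forall>\<^sub>F n in sequentially. \<not> (\<exists>I\<subseteq>{..<n}. P I \<and> a * real n \<le> real (card I))"
      by (simp add: Q_def not_frequently)
    then show "\<forall>\<^sub>F n in sequentially. real (card (J \<inter> {..<n})) / real n < a"
      using eventually_gt_at_top[of 0]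
    proof eventually_elim
      fix n :: nat assume n: "\<not> (\<exists>I\<subseteq>{..<n}. P I \<and> a * real n \<le> real (card I))" "0 < n"
      have "\<not> a * real n \<le> real (card (J \<inter> {..<n}))"
      proof
        assume "a * real n \<le> real (card (J \<inter> {..<n}))"
        then have "\<exists>I\<subseteq>{..<n}. P I \<and> a * real n \<le> real (card I)"
          using PJ[of n] by (intro exI[of _ "J \<inter> {..<n}"]) simp
        with n(1) show False ..
      qed
      then show "real (card (J \<inter> {..<n})) / real n < a" using n(2) by (simp add: field_simps)
    qed
  qed
  then show ?thesis using that PJ d by blast
qed

lemma densely_independent_realization:
  assumes "densely_independent X T A k" "0 < k" "T ` X \<subseteq> X"
  obtains J d where "\<And>n. indep_times X T A k (J \<inter> {..<n})" "0 < d"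
    "(\<lambda>n. real (card (J \<inter> {..<n})) / real n) \<longlonglongrightarrow> d"
proof -
  obtain c where "0 < c" "\<exists>\<^sub>F n in sequentially.
      \<exists>I \<subseteq> {..<n}. indep_times X T A k I \<and> c * real n \<le> real (card I)"
    using assms(1) unfolding densely_independent_def by blast
  then show ?thesis
    using density_realization[of "indep_times X T A k" c] that
      indep_times_subset[of X T A k] indep_times_shift[of X T A k] assms(2,3) by blast
qed

section \<open>Passing between independence sets of positive density and dense independence\<close>

text \<open>\<open>T\<close> cancels \<open>inv_into X T\<close> on \<open>X\<close>. Going back
  \<open>n\<close> steps turns all times \<open>\<ge> - n\<close>, negative ones included, into
  nonnegative ones.\<close>

lemma Tpow_inv_into:
  assumes "T ` X = X" "x \<in> X" "- int n \<le> s"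
  shows "(T ^^ nat (s + int n)) ((inv_into X T ^^ n) x) = Tpow X T s x"
proof -
  let ?g = "inv_into X T"
  have inv: "(T ^^ m) ((?g ^^ m) y) = y" if "y \<in> X" for m y
    using that
  proof (induction m arbitrary: y)
    case (Suc m)
    have "(?g ^^ m) y \<in> X"
      using Suc.prems assms(1) by (intro funpow_mem) (auto intro: inv_into_into)
    then have "T (?g ((?g ^^ m) y)) = (?g ^^ m) y"
      using assms(1) by (simp add: f_inv_into_f)
    then show ?case using Suc by (simp add: funpow_swap1)
  qed simp
  have gX: "(?g ^^ m) x \<in> X" for m
    using assms(1,2) by (intro funpow_mem) (auto intro: inv_into_into)
  show ?thesis
  proof (cases "0 \<le> s")
    case True
    then have "nat (s + int n) = nat s + n" by simp
    then show ?thesis using inv[OF assms(2)] True by (simp add: Tpow_def funpow_add)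
  next
    case False
    define m where "m = nat (s + int n)"
    have n: "n = m + nat (- s)" using False assms(3) by (simp add: m_def)
    have "(T ^^ m) ((?g ^^ n) x) = (?g ^^ nat (- s)) x"
      unfolding n funpow_add comp_def by (rule inv[OF gX])
    then show ?thesis using False by (simp add: Tpow_def m_def)
  qed
qed

lemma indep_set_iff_indep_times:
  assumes "\<And>s. s \<in> J \<Longrightarrow> 0 \<le> s"
  shows "indep_set X T As J \<longleftrightarrow>
    (\<forall>I. I \<noteq> {} \<and> finite I \<and> int ` I \<subseteq> J \<longrightarrow> indep_times X T (\<lambda>i. As ! i) (length As) I)"
proof (intro iffI allI impI)
  fix I assume ind: "indep_set X T As J" and I: "I \<noteq> {} \<and> finite I \<and> int ` I \<subseteq> J"
  show "indep_times X T (\<lambda>i. As ! i) (length As) I"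
    unfolding indep_times_def
  proof (intro allI impI)
    fix \<sigma> assume "\<forall>s\<in>I. \<sigma> s < length As"
    then have "(\<Inter>s\<in>int ` I. preim X T s (As ! (\<sigma> \<circ> nat) s)) \<noteq> {}"
      using I by (intro ind[unfolded indep_set_def, rule_format]) auto
    then obtain x where "x \<in> (\<Inter>s\<in>int ` I. preim X T s (As ! (\<sigma> \<circ> nat) s))" by blast
    then show "\<exists>x\<in>X. \<forall>s\<in>I. (T ^^ s) x \<in> As ! \<sigma> s"
      using I by (auto simp: preim_def Tpow_def)
  qed
next
  assume R: "\<forall>I. I \<noteq> {} \<and> finite I \<and> int ` I \<subseteq> J \<longrightarrow> indep_times X T (\<lambda>i. As ! i) (length As) I"
  show "indep_set X T As J"
    unfolding indep_set_def
  proof (intro allI impI, elim conjE)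
    fix I \<sigma> assume I: "I \<noteq> {}" "finite I" "I \<subseteq> J" "\<forall>s\<in>I. \<sigma> s < length As"
    have int_nat: "int (nat s) = s" if "s \<in> I" for s using assms I(3) that by auto
    have "int ` nat ` I = I" using int_nat by (force simp: image_iff)
    then have "indep_times X T (\<lambda>i. As ! i) (length As) (nat ` I)"
      using R I by simp
    moreover have "\<forall>s\<in>nat ` I. (\<sigma> \<circ> int) s < length As" using I(4) int_nat by auto
    ultimately obtain x where "x \<in> X" "\<forall>s\<in>nat ` I. (T ^^ s) x \<in> As ! (\<sigma> \<circ> int) s"
      unfolding indep_times_def by blast
    then have "x \<in> (\<Inter>s\<in>I. preim X T s (As ! \<sigma> s))"
      using int_nat assms I(3) by (auto simp: preim_def Tpow_def)
    then show "(\<Inter>s\<in>I. preim X T s (As ! \<sigma> s)) \<noteq> {}" by blast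
  qed
qed

lemma eventually_ge_of_nonzero_limit:
  assumes "(\<lambda>n. real (f n) / real (g n)) \<longlonglongrightarrow> d" "d \<noteq> 0" "\<And>n. 0 < g n"
  obtains c :: real where "0 < c" "\<forall>\<^sub>F n in sequentially. c * real (g n) \<le> real (f n)"
proof
  have "0 \<le> d" by (rule LIMSEQ_le_const[OF assms(1)]) auto
  then show "0 < d / 2" using assms(2) by simp
  then have "\<forall>\<^sub>F n in sequentially. d / 2 < real (f n) / real (g n)"
    by (intro order_tendstoD(1)[OF assms(1)]) simp
  then show "\<forall>\<^sub>F n in sequentially. d / 2 * real (g n) \<le> real (f n)"
    by eventually_elim (use assms(3) in \<open>simp add: pos_less_divide_eq less_imp_le\<close>)
qed

text \<open>Densities are measured in windows of length \<open>n + 1\<close> or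
  \<open>2 * n + 1\<close>; this passes from such lengths to infinitely many window lengths.\<close>

lemma frequently_at_larger:
  assumes "\<forall>\<^sub>F n in sequentially. P (g n)" "\<And>n. n \<le> g n"
  shows "\<exists>\<^sub>F n in sequentially. P n"
  unfolding frequently_sequentially
proof
  fix m
  obtain N where N: "\<forall>n\<ge>N. P (g n)" using assms(1) by (auto simp: eventually_sequentially)
  show "\<exists>n\<ge>m. P n"
    using N assms(2)[of "max m N"] by (intro exI[of _ "g (max m N)"]) auto
qed

text \<open>The part of \<open>J\<close> in a window has size at least proportional to its length.
  For the integers the window from \<open>- n\<close> to \<open>n\<close> is moved to start at 0 by
  applying the \<open>n\<close>-fold inverse to the realising point.\<close>

lemma densely_independent_of_indep_set:
  assumes "T ` X = X" "J \<subseteq> actG isZ" "indep_set X T As J" "pos_density isZ J"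
  shows "densely_independent X T (\<lambda>i. As ! i) (length As)"
proof (cases isZ)
  case False
  obtain d where d: "d \<noteq> 0" "(\<lambda>n. real (card (J \<inter> {0..int n})) / real (n + 1)) \<longlonglongrightarrow> d"
    using assms(4) False by (auto simp: pos_density_def)
  obtain c where c: "0 < c" "\<forall>\<^sub>F n in sequentially. c * real (n + 1) \<le> real (card (J \<inter> {0..int n}))"
    using eventually_ge_of_nonzero_limit[OF d(2,1)] by auto
  have J: "0 \<le> s" if "s \<in> J" for s using assms(2) that False by (auto simp: actG_def)
  have "\<forall>\<^sub>F n in sequentially. \<exists>I\<subseteq>{..<n + 1}. indep_times X T (\<lambda>i. As ! i) (length As) I
      \<and> c * real (n + 1) \<le> real (card I)"
    using c(2)
  proof eventually_elim
    fix n assume n: "c * real (n + 1) \<le> real (card (J \<inter> {0..int n}))"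
    let ?I = "nat ` (J \<inter> {0..int n})"
    have "int ` ?I = J \<inter> {0..int n}" by (force simp: image_iff)
    \<comment> \<open>\<open>indep_set\<close> speaks of nonempty finite sets only; the density
      bound excludes the empty window.\<close>
    moreover have "?I \<noteq> {}"
    proof
      assume "?I = {}"
      then have "J \<inter> {0..int n} = {}" by blast
      then have "c * real (n + 1) \<le> 0" using n by simp
      then show False using c(1) by (simp add: mult_le_0_iff)
    qed
    ultimately have "indep_times X T (\<lambda>i. As ! i) (length As) ?I"
      using indep_set_iff_indep_times[of J X T As] J assms(3) by auto
    moreover have "card ?I = card (J \<inter> {0..int n})"
      by (rule card_image) (auto intro!: inj_onI)
    moreover have "?I \<subseteq> {..<n + 1}" by auto
    ultimately show "\<exists>I\<subseteq>{..<n + 1}. indep_times X T (\<lambda>i. As ! i) (length As) I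
      \<and> c * real (n + 1) \<le> real (card I)" using n by metis
  qed
  then have "\<exists>\<^sub>F n in sequentially. \<exists>I\<subseteq>{..<n}. indep_times X T (\<lambda>i. As ! i) (length As) I
      \<and> c * real n \<le> real (card I)"
    by (rule frequently_at_larger) simp
  then show ?thesis using c(1) unfolding densely_independent_def by blast
next
  case True
  obtain d where d: "d \<noteq> 0" "(\<lambda>n. real (card (J \<inter> {- int n..int n})) / real (2 * n + 1)) \<longlonglongrightarrow> d"
    using assms(4) True by (auto simp: pos_density_def)
  obtain c where c: "0 < c" "\<forall>\<^sub>F n in sequentially. c * real (2 * n + 1) \<le> real (card (J \<inter> {- int n..int n}))"
    using eventually_ge_of_nonzero_limit[OF d(2,1)] by auto
  have "\<forall>\<^sub>F n in sequentially. \<exists>I\<subseteq>{..<2 * n + 1}. indep_times X T (\<lambda>i. As ! i) (length As) I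
      \<and> c * real (2 * n + 1) \<le> real (card I)"
    using c(2)
  proof eventually_elim
    fix n assume n: "c * real (2 * n + 1) \<le> real (card (J \<inter> {- int n..int n}))"
    let ?J = "J \<inter> {- int n..int n}"
    let ?f = "\<lambda>s. nat (s + int n)"
    have "?J \<noteq> {}"
    proof
      assume "?J = {}"
      then have "c * real (2 * n + 1) \<le> 0" using n by (metis card.empty of_nat_0)
      then show False using c(1) by (simp add: mult_le_0_iff)
    qed
    have "indep_times X T (\<lambda>i. As ! i) (length As) (?f ` ?J)"
      unfolding indep_times_def
    proof (intro allI impI)
      fix \<sigma> assume "\<forall>s\<in>?f ` ?J. \<sigma> s < length As"
      then have "(\<Inter>s\<in>?J. preim X T s (As ! (\<sigma> \<circ> ?f) s)) \<noteq> {}"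
        using \<open>?J \<noteq> {}\<close> by (intro assms(3)[unfolded indep_set_def, rule_format]) auto
      then obtain x where x: "x \<in> (\<Inter>s\<in>?J. preim X T s (As ! (\<sigma> \<circ> ?f) s))" by blast
      then have "x \<in> X" using \<open>?J \<noteq> {}\<close> unfolding preim_def by blast
      let ?y = "(inv_into X T ^^ n) x"
      have "?y \<in> X"
        using \<open>x \<in> X\<close> assms(1) by (intro funpow_mem) (auto intro: inv_into_into)
      moreover have "(T ^^ ?f s) ?y \<in> As ! \<sigma> (?f s)" if "s \<in> ?J" for s
      proof -
        have "Tpow X T s x \<in> As ! \<sigma> (?f s)" using x that unfolding preim_def comp_def by blast
        then show ?thesis
          using Tpow_inv_into[OF assms(1) \<open>x \<in> X\<close>, of n s] that by simp
      qed
      ultimately show "\<exists>x\<in>X. \<forall>s\<in>?f ` ?J. (T ^^ s) x \<in> As ! \<sigma> s" by blast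
    qed
    moreover have "card (?f ` ?J) = card ?J"
      by (rule card_image) (auto intro!: inj_onI)
    moreover have "?f ` ?J \<subseteq> {..<2 * n + 1}" by auto
    ultimately show "\<exists>I\<subseteq>{..<2 * n + 1}. indep_times X T (\<lambda>i. As ! i) (length As) I
      \<and> c * real (2 * n + 1) \<le> real (card I)" using n by metis
  qed
  then have "\<exists>\<^sub>F n in sequentially. \<exists>I\<subseteq>{..<n}. indep_times X T (\<lambda>i. As ! i) (length As) I
      \<and> c * real n \<le> real (card I)"
    by (rule frequently_at_larger) simp
  then show ?thesis using c(1) unfolding densely_independent_def by blast
qed

text \<open>One set of natural times with a genuine density \<open>d\<close> serves both cases;
  viewed inside the integers its density is \<open>d / 2\<close>.\<close>

lemma indep_set_of_densely_independent:
  assumes "T ` X \<subseteq> X" "0 < length As" "densely_independent X T (\<lambda>i. As ! i) (length As)"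
  shows "\<exists>J \<subseteq> actG isZ. indep_set X T As J \<and> pos_density isZ J"
proof -
  obtain J d where J: "\<And>n. indep_times X T (\<lambda>i. As ! i) (length As) (J \<inter> {..<n})" "0 < d"
    "(\<lambda>n. real (card (J \<inter> {..<n})) / real n) \<longlonglongrightarrow> d"
    using densely_independent_realization[OF assms(3,2,1)] by metis
  have "indep_set X T As (int ` J)"
  proof (subst indep_set_iff_indep_times, force, intro allI impI)
    fix I assume I: "I \<noteq> {} \<and> finite I \<and> int ` I \<subseteq> int ` J"
    then obtain n where "I \<subseteq> {..<n}" by (meson finite_nat_iff_bounded)
    then have "I \<subseteq> J \<inter> {..<n}" using I by auto
    then show "indep_times X T (\<lambda>i. As ! i) (length As) I"
      using indep_times_subset[OF J(1)] assms(2) by blast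
  qed
  moreover have "pos_density isZ (int ` J)"
  proof -
    have lim: "(\<lambda>n. real (card (J \<inter> {..<n + 1})) / real (n + 1)) \<longlonglongrightarrow> d"
      using LIMSEQ_ignore_initial_segment[OF J(3), of 1] .
    have "int ` J \<inter> {0..int n} = int ` (J \<inter> {..<n + 1})"
      "int ` J \<inter> {- int n..int n} = int ` (J \<inter> {..<n + 1})" for n by auto
    then have card: "card (int ` J \<inter> {0..int n}) = card (J \<inter> {..<n + 1})"
      "card (int ` J \<inter> {- int n..int n}) = card (J \<inter> {..<n + 1})" for n
      by (simp_all add: card_image)
    have "(\<lambda>n. inverse (2 - inverse (real (Suc n)))) \<longlonglongrightarrow> inverse (2 - 0)"
      by (intro tendsto_intros LIMSEQ_inverse_real_of_nat) simp
    moreover have "inverse (2 - inverse (real (Suc n))) = real (n + 1) / real (2 * n + 1)" for n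
      by (simp add: field_simps)
    ultimately have "(\<lambda>n. real (n + 1) / real (2 * n + 1)) \<longlonglongrightarrow> 1 / 2" by simp
    from tendsto_mult[OF lim this]
    have lim2: "(\<lambda>n. real (card (J \<inter> {..<n + 1})) / real (2 * n + 1)) \<longlonglongrightarrow> d / 2"
      by (simp add: divide_simps del: of_nat_Suc of_nat_add of_nat_mult split: if_splits)
    show ?thesis
    proof (cases isZ)
      case True
      then show ?thesis
        unfolding pos_density_def card using lim2 J(2)
        by (simp only: if_True) (rule exI[of _ "d / 2"], simp)
    next
      case False
      then show ?thesis
        unfolding pos_density_def card using lim J(2)
        by (simp only: if_False) (rule exI[of _ d], simp)
    qed
  qed
  moreover have "int ` J \<subseteq> actG isZ" by (auto simp: actG_def)
  ultimately show ?thesis by blast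
qed

section \<open>Return times\<close>

definition pos_upper_density :: "nat set \<Rightarrow> bool" where
  "pos_upper_density B \<longleftrightarrow>
     (\<exists>c::real > 0. \<exists>\<^sub>F n in sequentially. c * real n \<le> real (card (B \<inter> {..<n})))"

text \<open>Pigeonhole: in infinitely many windows some \<open>C i\<close> has a fixed share of
  \<open>B\<close>, and as \<open>S\<close> is finite the same \<open>i\<close> recurs.\<close>

lemma pos_upper_density_UN:
  assumes "finite S" "pos_upper_density B" "B \<subseteq> (\<Union>i\<in>S. C i)"
  shows "\<exists>i\<in>S. pos_upper_density (C i)"
proof -
  obtain c where c: "0 < c" "\<exists>\<^sub>F n in sequentially. c * real n \<le> real (card (B \<inter> {..<n}))"
    using assms(2) unfolding pos_upper_density_def by blast
  \<comment> \<open>Dividing by \<open>card S + 1\<close> makes the total of the shares strictly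
    less than \<open>c\<close>.\<close>
  let ?c = "c / (real (card S) + 1)"
  have "\<exists>\<^sub>F n in sequentially. 0 < n \<and> c * real n \<le> real (card (B \<inter> {..<n}))"
    using frequently_eventually_frequently[OF c(2) eventually_gt_at_top[of 0]]
    by (simp add: conj_commute)
  moreover have "\<exists>i\<in>S. ?c * real n \<le> real (card (C i \<inter> {..<n}))"
    if n: "0 < n \<and> c * real n \<le> real (card (B \<inter> {..<n}))" for n
  proof (rule ccontr)
    assume no: "\<not> (\<exists>i\<in>S. ?c * real n \<le> real (card (C i \<inter> {..<n})))"
    have "card (B \<inter> {..<n}) \<le> card (\<Union>i\<in>S. C i \<inter> {..<n})"
      using assms(1,3) by (intro card_mono) auto
    also have "\<dots> \<le> (\<Sum>i\<in>S. card (C i \<inter> {..<n}))" using assms(1) by (rule card_UN_le)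
    finally have "real (card (B \<inter> {..<n})) \<le> (\<Sum>i\<in>S. real (card (C i \<inter> {..<n})))"
      by (metis of_nat_le_iff of_nat_sum)
    also have "\<dots> \<le> (\<Sum>i\<in>S. ?c * real n)" using no by (intro sum_mono) force
    also have "\<dots> = real (card S) / (real (card S) + 1) * (c * real n)" by simp
    also have "\<dots> < 1 * (c * real n)"
      using n c(1) by (intro mult_strict_right_mono) (auto simp: field_simps)
    finally show False using n by simp
  qed
  ultimately have "\<exists>\<^sub>F n in sequentially. \<exists>i\<in>S. ?c * real n \<le> real (card (C i \<inter> {..<n}))"
    by (rule frequently_elim1)
  then have "\<exists>i\<in>S. \<exists>\<^sub>F n in sequentially. ?c * real n \<le> real (card (C i \<inter> {..<n}))"
    using assms(1) by (simp add: frequently_bex_finite_distrib)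
  moreover have "0 < ?c" using c(1) by (simp add: add_nonneg_pos)
  ultimately show ?thesis unfolding pos_upper_density_def by blast
qed

text \<open>In a window of length \<open>M\<close>, all elements of \<open>B'\<close> lie within
  \<open>m\<close> of the least one, since a later one would be a return after at least
  \<open>m\<close> and at most \<open>M\<close> steps.\<close>

lemma card_no_return_le:
  assumes "B' \<subseteq> B" "\<And>s t. s \<in> B' \<Longrightarrow> t \<in> B \<Longrightarrow> s + m \<le> t \<Longrightarrow> s + M < t"
  shows "card (B' \<inter> {..<i * M}) \<le> i * m"
proof (induction i)
  case (Suc i)
  let ?W = "B' \<inter> {i * M..<Suc i * M}"
  have "card ?W \<le> m"
  proof (cases "?W = {}")
    case False
    define s where "s = (LEAST s. s \<in> ?W)"
    have s: "s \<in> ?W" unfolding s_def using False by (metis LeastI_ex ex_in_conv)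
    have "?W \<subseteq> {s..<s + m}"
    proof
      fix t assume t: "t \<in> ?W"
      then have "s \<le> t" unfolding s_def by (rule Least_le)
      moreover have "t < s + m"
        using assms(2)[of s t] assms(1) s t by (cases "s + m \<le> t") auto
      ultimately show "t \<in> {s..<s + m}" by simp
    qed
    then show ?thesis using card_mono[of "{s..<s + m}" ?W] by simp
  qed simp
  moreover have "B' \<inter> {..<Suc i * M} = (B' \<inter> {..<i * M}) \<union> ?W" by auto
  then have "card (B' \<inter> {..<Suc i * M}) \<le> card (B' \<inter> {..<i * M}) + card ?W"
    by (metis card_Un_le)
  ultimately show ?case using Suc by simp
qed simp

text \<open>The points of \<open>B\<close> that do not return to \<open>B\<close> within the times \<open>m, \<dots>, M\<close> have density at most
  \<open>m / M\<close>.\<close>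
lemma pos_upper_density_return:
  assumes "pos_upper_density B" "0 < m"
  obtains h where "m \<le> h" "pos_upper_density {s \<in> B. s + h \<in> B}"
proof -
  obtain c where c: "0 < c" "\<exists>\<^sub>F n in sequentially. c * real n \<le> real (card (B \<inter> {..<n}))"
    using assms(1) unfolding pos_upper_density_def by blast
  \<comment> \<open>With this \<open>M\<close> the ratio \<open>m / M\<close> is at most
    \<open>c / 4\<close>, so the points without return cannot use up the density of
    \<open>B\<close>.\<close>
  define M where "M = nat \<lceil>4 * real m / c\<rceil> + 1"
  have M: "4 * real m \<le> c * real M" "0 < M"
  proof -
    have "4 * real m / c \<le> real M" unfolding M_def by linarith
    then show "4 * real m \<le> c * real M" using c(1) by (simp add: field_simps)
  qed (simp add: M_def)
  define B' where "B' = {s \<in> B. \<forall>t\<in>B. s + m \<le> t \<longrightarrow> s + M < t}"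
  have B': "real (card (B' \<inter> {..<n})) \<le> c / 4 * real n + real m" for n
  proof -
    define i where "i = n div M + 1"
    have "n < i * M" unfolding i_def using M(2) by (metis Suc_eq_plus1 dividend_less_times_div mult.commute mult_Suc_right
        add.commute)
    then have "card (B' \<inter> {..<n}) \<le> card (B' \<inter> {..<i * M})" by (intro card_mono) auto
    also have "\<dots> \<le> i * m"
      by (intro card_no_return_le[of _ B]) (auto simp: B'_def)
    finally have "real (card (B' \<inter> {..<n})) \<le> real (i * m)" by (rule of_nat_mono)
    also have "\<dots> = real (n div M) * real m + real m" by (simp add: i_def algebra_simps)
    also have "real (n div M) * real m \<le> c / 4 * real n"
    proof -
      have "real (n div M) * (4 * real m) \<le> real (n div M) * (c * real M)"
        using M(1) by (intro mult_left_mono) auto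
      also have "\<dots> = c * real (n div M * M)" by simp
      also have "\<dots> \<le> c * real n" using c(1) by (intro mult_left_mono of_nat_mono) auto
      finally show ?thesis by simp
    qed
    finally show ?thesis by simp
  qed
  have "\<forall>\<^sub>F n in sequentially. real m \<le> c / 4 * real n"
    using c(1) by (intro eventually_sequentiallyI[of "nat \<lceil>4 * real m / c\<rceil>"])
      (simp add: field_simps nat_le_iff ceiling_le_iff)
  from frequently_eventually_frequently[OF c(2) this]
  have "\<exists>\<^sub>F n in sequentially. c / 2 * real n \<le> real (card ((B - B') \<inter> {..<n}))"
  proof (rule frequently_elim1)
    fix n assume n: "c * real n \<le> real (card (B \<inter> {..<n})) \<and> real m \<le> c / 4 * real n"
    have "B \<inter> {..<n} \<subseteq> ((B - B') \<inter> {..<n}) \<union> (B' \<inter> {..<n})" by blast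
    then have "card (B \<inter> {..<n}) \<le> card (((B - B') \<inter> {..<n}) \<union> (B' \<inter> {..<n}))"
      by (intro card_mono) auto
    also have "\<dots> \<le> card ((B - B') \<inter> {..<n}) + card (B' \<inter> {..<n})" by (rule card_Un_le)
    finally show "c / 2 * real n \<le> real (card ((B - B') \<inter> {..<n}))"
      using n B'[of n] by linarith
  qed
  then have "pos_upper_density (B - B')"
    using c(1) unfolding pos_upper_density_def by (intro exI[of _ "c / 2"]) simp
  moreover have "B - B' \<subseteq> (\<Union>h\<in>{m..M}. {s \<in> B. s + h \<in> B})"
  proof
    fix s assume "s \<in> B - B'"
    then obtain t where t: "s \<in> B" "t \<in> B" "s + m \<le> t" "t \<le> s + M"
      by (auto simp: B'_def not_less)
    then show "s \<in> (\<Union>h\<in>{m..M}. {s \<in> B. s + h \<in> B})"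
      by (intro UN_I[of "t - s"]) auto
  qed
  ultimately obtain h where "h \<in> {m..M}" "pos_upper_density {s \<in> B. s + h \<in> B}"
    using pos_upper_density_UN[of "{m..M}"] by blast
  then show ?thesis using that[of h] by (simp only: atLeastAtMost_iff)
qed

text \<open>Return times are found one by one, each for the set of points that already have the
  earlier returns.\<close>

lemma pos_upper_density_returns:
  assumes "finite \<Gamma>" "pos_upper_density B" "0 < m"
  obtains h where "inj_on h \<Gamma>" "\<And>\<gamma>. \<gamma> \<in> \<Gamma> \<Longrightarrow> m \<le> h \<gamma>"
    "pos_upper_density {s \<in> B. \<forall>\<gamma>\<in>\<Gamma>. s + h \<gamma> \<in> B}"
proof -
  have "\<exists>h::'a \<Rightarrow> nat. inj_on h \<Gamma> \<and> (\<forall>\<gamma>\<in>\<Gamma>. m \<le> h \<gamma>) \<and>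
      pos_upper_density {s \<in> B. \<forall>\<gamma>\<in>\<Gamma>. s + h \<gamma> \<in> B}"
    using assms(1)
  proof (induction \<Gamma> rule: finite_induct)
    case empty
    then show ?case using assms(2) by simp
  next
    case (insert \<gamma> \<Gamma>)
    then obtain h :: "'a \<Rightarrow> nat" where h: "inj_on h \<Gamma>" "\<forall>\<gamma>\<in>\<Gamma>. m \<le> h \<gamma>"
      "pos_upper_density {s \<in> B. \<forall>\<gamma>\<in>\<Gamma>. s + h \<gamma> \<in> B}" by blast
    let ?B = "{s \<in> B. \<forall>\<gamma>\<in>\<Gamma>. s + h \<gamma> \<in> B}"
    \<comment> \<open>Asking for more than the sum of the earlier return times makes the new one
      different from all of them.\<close>
    let ?m = "m + Suc (sum h \<Gamma>)"
    obtain l where l: "?m \<le> l" "pos_upper_density {s \<in> ?B. s + l \<in> ?B}"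
      using pos_upper_density_return[OF h(3), of ?m] by auto
    have "h x < l" if "x \<in> \<Gamma>" for x
      using member_le_sum[of x \<Gamma> h] that insert.hyps(1) l(1) by simp
    then have "inj_on (h(\<gamma> := l)) (insert \<gamma> \<Gamma>)"
      using h(1) insert.hyps(2) by (auto simp: inj_on_def less_le)
    moreover have "\<forall>x\<in>insert \<gamma> \<Gamma>. m \<le> (h(\<gamma> := l)) x" using h(2) l(1) by auto
    moreover have "{s \<in> ?B. s + l \<in> ?B} \<subseteq> {s \<in> B. \<forall>x\<in>insert \<gamma> \<Gamma>. s + (h(\<gamma> := l)) x \<in> B}"
      by auto
    with l(2) have "pos_upper_density {s \<in> B. \<forall>x\<in>insert \<gamma> \<Gamma>. s + (h(\<gamma> := l)) x \<in> B}"
      \<comment> \<open>With a one-element index set, the covering lemma expresses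
        monotonicity.\<close>
      using pos_upper_density_UN[of "{()}" _ "\<lambda>_. {s \<in> B. \<forall>x\<in>insert \<gamma> \<Gamma>. s + (h(\<gamma> := l)) x \<in> B}"]
      by simp
    ultimately show ?case by blast
  qed
  then show ?thesis using that by blast
qed

lemma densely_independentI:
  assumes "pos_upper_density J" "\<And>n. indep_times X T A k (J \<inter> {..<n})"
  shows "densely_independent X T A k"
proof -
  obtain c where c: "0 < c" "\<exists>\<^sub>F n in sequentially. c * real n \<le> real (card (J \<inter> {..<n}))"
    using assms(1) unfolding pos_upper_density_def by blast
  from c(2) have "\<exists>\<^sub>F n in sequentially.
      \<exists>I \<subseteq> {..<n}. indep_times X T A k I \<and> c * real n \<le> real (card I)"
    by (rule frequently_elim1) (intro exI[of _ "J \<inter> {..<n}" for n] conjI assms(2), auto)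
  then show ?thesis using c(1) unfolding densely_independent_def by blast
qed

text \<open>If \<open>s\<close> runs through one residue class modulo a number exceeding all \<open>h \<gamma>\<close>, the times \<open>s\<close>,
  \<open>s + h \<gamma>\<close> are pairwise distinct, so the conditions at these times can be prescribed independently.\<close>
lemma densely_independent_return:
  assumes "densely_independent X T A k" "0 < k" "T ` X \<subseteq> X" "finite \<Gamma>" "0 < m"
    "\<forall>j<l. p j < k" "\<forall>\<gamma>\<in>\<Gamma>. \<forall>j<l. q \<gamma> j < k"
  obtains h where "\<forall>\<gamma>\<in>\<Gamma>. m \<le> h \<gamma>"
    "densely_independent X T (\<lambda>j. {x \<in> X. x \<in> A (p j) \<and> (\<forall>\<gamma>\<in>\<Gamma>. (T ^^ h \<gamma>) x \<in> A (q \<gamma> j))}) l"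
proof -
  obtain J d where J: "\<And>n. indep_times X T A k (J \<inter> {..<n})" "0 < d"
    "(\<lambda>n. real (card (J \<inter> {..<n})) / real n) \<longlonglongrightarrow> d"
    using densely_independent_realization[OF assms(1-3)] by metis
  have "\<forall>\<^sub>F n in sequentially. d / 2 < real (card (J \<inter> {..<n})) / real n"
    using J(2) by (intro order_tendstoD(1)[OF J(3)]) simp
  then have "\<forall>\<^sub>F n in sequentially. d / 2 * real n \<le> real (card (J \<inter> {..<n}))"
    using eventually_gt_at_top[of 0]
    by eventually_elim (simp add: pos_less_divide_eq less_imp_le)
  then have "pos_upper_density J"
    unfolding pos_upper_density_def using J(2)
    by (intro exI[of _ "d / 2"]) (auto intro: eventually_frequently)
  from pos_upper_density_returns[OF assms(4) this assms(5)]
  obtain h where h: "inj_on h \<Gamma>" "\<And>\<gamma>. \<gamma> \<in> \<Gamma> \<Longrightarrow> m \<le> h \<gamma>"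
    "pos_upper_density {s \<in> J. \<forall>\<gamma>\<in>\<Gamma>. s + h \<gamma> \<in> J}" by blast
  let ?B = "{s \<in> J. \<forall>\<gamma>\<in>\<Gamma>. s + h \<gamma> \<in> J}"
  define M where "M = Suc (sum h \<Gamma>)"
  have hM: "h \<gamma> < M" if "\<gamma> \<in> \<Gamma>" for \<gamma>
    using member_le_sum[of \<gamma> \<Gamma> h] that assms(4) by (simp add: M_def)
  have "?B \<subseteq> (\<Union>r\<in>{..<M}. {s \<in> ?B. s mod M = r})" by (auto simp: M_def)
  then obtain r where r: "pos_upper_density {s \<in> ?B. s mod M = r}"
    using pos_upper_density_UN[of "{..<M}"] h(3) by blast
  let ?C = "{s \<in> ?B. s mod M = r}"
  \<comment> \<open>Since \<open>s\<close> is \<open>r\<close> modulo \<open>M\<close> and the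
    increment is below \<open>M\<close>, dividing \<open>s + a - r\<close> by \<open>M\<close>
    recovers the quotient of \<open>s\<close>.\<close>
  have uniq: "s = s' \<and> a = a'" if "s \<in> ?C" "s' \<in> ?C" "s + a = s' + a'" "a < M" "a' < M" for s s' a a'
  proof -
    have *: "t div M = (t + b - r) div M" if "t mod M = r" "b < M" for t b
    proof -
      have "t + b - r = M * (t div M) + b"
        using mult_div_mod_eq[of M t] that(1) by linarith
      then show ?thesis using that(2) by simp
    qed
    have mods: "s mod M = r" "s' mod M = r" using that(1,2) by auto
    have "s div M = s' div M"
      using *[OF mods(1) that(4)] *[OF mods(2) that(5)] that(3) by metis
    then have "s = s'" using mods by (metis mult_div_mod_eq)
    then show ?thesis using that(3) by simp
  qed
  have "indep_times X T (\<lambda>j. {x \<in> X. x \<in> A (p j) \<and> (\<forall>\<gamma>\<in>\<Gamma>. (T ^^ h \<gamma>) x \<in> A (q \<gamma> j))}) l (?C \<inter> {..<n})" for n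
    unfolding indep_times_def
  proof (intro allI impI)
    fix \<sigma> assume \<sigma>: "\<forall>s\<in>?C \<inter> {..<n}. \<sigma> s < l"
    define D where "D = ?C \<inter> {..<n}"
    \<comment> \<open>\<open>R t i\<close> records that the orbit has to be in \<open>A i\<close> at
      time \<open>t\<close>. By \<open>uniq\<close> each time carries at most one such demand, so
      \<open>\<tau>\<close> is a single pattern meeting all of them.\<close>
    define R where "R t i \<longleftrightarrow> (t \<in> D \<and> i = p (\<sigma> t)) \<or>
        (\<exists>s\<in>D. \<exists>\<gamma>\<in>\<Gamma>. t = s + h \<gamma> \<and> i = q \<gamma> (\<sigma> s))" for t i
    define \<tau> where "\<tau> t = (SOME i. R t i)" for t
    have h0: "0 < h \<gamma>" if "\<gamma> \<in> \<Gamma>" for \<gamma> using h(2)[OF that] assms(5) by simp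
    have R_fun: "i = i'" if "R t i" "R t i'" for t i i'
    proof -
      have M0: "0 < M" by (simp add: M_def)
      have ne: "t \<noteq> s + h \<gamma>" if "t \<in> D" "s \<in> D" "\<gamma> \<in> \<Gamma>" for t s \<gamma>
        using uniq[of t s 0 "h \<gamma>"] that[unfolded D_def] h0[OF that(3)] hM[OF that(3)] M0 by auto
      have eq: "s = s' \<and> \<gamma> = \<gamma>'"
        if "s \<in> D" "s' \<in> D" "\<gamma> \<in> \<Gamma>" "\<gamma>' \<in> \<Gamma>" "s + h \<gamma> = s' + h \<gamma>'" for s s' \<gamma> \<gamma>'
        using uniq[of s s' "h \<gamma>" "h \<gamma>'"] that[unfolded D_def] hM h(1) by (auto dest: inj_onD)
      show ?thesis
        using that unfolding R_def by (elim disjE bexE conjE) (metis ne eq)+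
    qed
    have \<tau>: "\<tau> t = i" if "R t i" for t i
      unfolding \<tau>_def using that R_fun by (metis someI)
    define I where "I = {t. \<exists>i. R t i}"
    \<comment> \<open>The times \<open>s + h \<gamma>\<close> can leave the window of length
      \<open>n\<close>, but by less than \<open>M\<close>.\<close>
    have "t < n + M" if "t \<in> I" for t
      using that hM unfolding I_def R_def D_def by fastforce
    moreover have "I \<subseteq> J" unfolding I_def R_def D_def by auto
    ultimately have "I \<subseteq> J \<inter> {..<n + M}" by auto
    then have "indep_times X T A k I" using indep_times_subset[OF J(1)] assms(2) by blast
    moreover have "\<forall>t\<in>I. \<tau> t < k"
    proof
      fix t assume "t \<in> I"
      then obtain i where i: "R t i" by (auto simp: I_def)
      then have "i < k" using \<sigma> assms(6,7) unfolding R_def D_def by auto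
      then show "\<tau> t < k" using \<tau>[OF i] by simp
    qed
    ultimately obtain x where x: "x \<in> X" "\<forall>t\<in>I. (T ^^ t) x \<in> A (\<tau> t)"
      unfolding indep_times_def by blast
    have xR: "(T ^^ t) x \<in> A i" if "R t i" for t i
      using x(2) \<tau>[OF that] that unfolding I_def by blast
    have "(T ^^ s) x \<in> {x \<in> X. x \<in> A (p (\<sigma> s)) \<and> (\<forall>\<gamma>\<in>\<Gamma>. (T ^^ h \<gamma>) x \<in> A (q \<gamma> (\<sigma> s)))}"
      if s: "s \<in> D" for s
    proof (intro CollectI conjI ballI)
      show "(T ^^ s) x \<in> X" using funpow_mem[OF assms(3) x(1)] .
      show "(T ^^ s) x \<in> A (p (\<sigma> s))" using s by (intro xR) (simp add: R_def)
      fix \<gamma> assume "\<gamma> \<in> \<Gamma>"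
      then have "(T ^^ (s + h \<gamma>)) x \<in> A (q \<gamma> (\<sigma> s))"
        using s by (intro xR) (auto simp: R_def)
      then show "(T ^^ h \<gamma>) ((T ^^ s) x) \<in> A (q \<gamma> (\<sigma> s))"
        by (metis add.commute comp_apply funpow_add)
    qed
    then show "\<exists>x\<in>X. \<forall>s\<in>?C \<inter> {..<n}. (T ^^ s) x \<in>
        {x \<in> X. x \<in> A (p (\<sigma> s)) \<and> (\<forall>\<gamma>\<in>\<Gamma>. (T ^^ h \<gamma>) x \<in> A (q \<gamma> (\<sigma> s)))}"
      using x(1) unfolding D_def by blast
  qed
  then have "densely_independent X T (\<lambda>j. {x \<in> X. x \<in> A (p j) \<and> (\<forall>\<gamma>\<in>\<Gamma>. (T ^^ h \<gamma>) x \<in> A (q \<gamma> j))}) l"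
    by (rule densely_independentI[OF r])
  then show ?thesis using that h(2) by blast
qed

section \<open>The Cantor scheme\<close>

lemma continuous_on_funpow:
  assumes "continuous_on X T" "T ` X \<subseteq> X"
  shows "continuous_on X (T ^^ n)"
proof (induction n)
  case (Suc n)
  have "(T ^^ n) ` X \<subseteq> X" using funpow_mem[OF assms(2)] by blast
  then show ?case
    using continuous_on_compose[OF Suc continuous_on_subset[OF assms(1)]] by simp
qed (simp add: continuous_on_id)

text \<open>One step of the construction: \<open>densely_independent_return\<close> is applied with
  all maps from new to old indices at once, and the resulting closed sets are then shrunk.\<close>

lemma densely_independent_refine:
  fixes X :: "'a::metric_space set"
  assumes "compact X" "continuous_on X T" "T ` X \<subseteq> X" "0 < k" "2 \<le> l"
    "densely_independent X T A k" "\<And>j. j < k \<Longrightarrow> closed (A j)" "\<And>j. j < l \<Longrightarrow> p j < k"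
    "0 < m" "0 < \<epsilon>"
  obtains B where "densely_independent X T B l"
    "\<forall>j<l. closed (B j) \<and> B j \<subseteq> X \<and> B j \<subseteq> A (p j)"
    "\<forall>j<l. \<forall>x\<in>B j. \<forall>y\<in>B j. dist x y \<le> \<epsilon>"
    "\<forall>\<gamma>. (\<forall>j<l. \<gamma> j < k) \<longrightarrow> (\<exists>h\<ge>m. \<forall>j<l. \<forall>x\<in>B j. (T ^^ h) x \<in> A (\<gamma> j))"
proof -
  let ?\<Gamma> = "{..<l} \<rightarrow>\<^sub>E {..<k}"
  have \<Gamma>: "\<forall>\<gamma>\<in>?\<Gamma>. \<forall>j<l. \<gamma> j < k" by auto
  have p: "\<forall>j<l. p j < k" using assms(8) by blast
  have "finite ?\<Gamma>" by (simp add: finite_PiE)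
  from densely_independent_return[where p = p and q = "\<lambda>\<gamma>. \<gamma>", OF assms(6,4,3) this assms(9) p \<Gamma>]
  obtain h where h: "\<forall>\<gamma>\<in>?\<Gamma>. m \<le> h \<gamma>"
    "densely_independent X T
      (\<lambda>j. {x \<in> X. x \<in> A (p j) \<and> (\<forall>\<gamma>\<in>?\<Gamma>. (T ^^ h \<gamma>) x \<in> A (\<gamma> j))}) l" .
  let ?C = "\<lambda>j. {x \<in> X. x \<in> A (p j) \<and> (\<forall>\<gamma>\<in>?\<Gamma>. (T ^^ h \<gamma>) x \<in> A (\<gamma> j))}"
  have "closed (?C j)" if j: "j < l" for j
  proof -
    have X: "closed X" using assms(1) by (rule compact_imp_closed)
    have "closed (X \<inter> (T ^^ h \<gamma>) -` A (\<gamma> j))" if "\<gamma> \<in> ?\<Gamma>" for \<gamma>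
      using continuous_on_funpow[OF assms(2,3)] X assms(7)[OF \<Gamma>[rule_format, OF that j]]
      by (rule continuous_closed_preimage)
    then have "closed (\<Inter>\<gamma>\<in>?\<Gamma>. X \<inter> (T ^^ h \<gamma>) -` A (\<gamma> j))" by (intro closed_INT ballI)
    then have "closed (X \<inter> A (p j) \<inter> (\<Inter>\<gamma>\<in>?\<Gamma>. X \<inter> (T ^^ h \<gamma>) -` A (\<gamma> j)))"
      using X assms(7)[OF assms(8)[OF j]] by (intro closed_Int)
    moreover have "?C j = X \<inter> A (p j) \<inter> (\<Inter>\<gamma>\<in>?\<Gamma>. X \<inter> (T ^^ h \<gamma>) -` A (\<gamma> j))" by blast
    ultimately show ?thesis by simp
  qed
  then have C: "closed (?C j) \<and> ?C j \<subseteq> X" if "j < l" for j using that by blast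
  from densely_independent_small[OF assms(1,5,10) h(2) C]
  obtain B where B: "densely_independent X T B l"
    "\<forall>j<l. closed (B j) \<and> B j \<subseteq> ?C j" "\<forall>j<l. \<forall>x\<in>B j. \<forall>y\<in>B j. dist x y \<le> \<epsilon>" .
  show ?thesis
  proof (rule that[OF B(1) _ B(3)]; intro allI impI)
    show "closed (B j) \<and> B j \<subseteq> X \<and> B j \<subseteq> A (p j)" if "j < l" for j
      using B(2) that by blast
    fix \<gamma> assume "\<forall>j<l. \<gamma> j < k"
    \<comment> \<open>Return times were chosen for the finitely many extensional maps; restricting
      \<open>\<gamma>\<close> picks the relevant one.\<close>
    then have \<gamma>: "restrict \<gamma> {..<l} \<in> ?\<Gamma>" by auto
    have "(T ^^ h (restrict \<gamma> {..<l})) x \<in> A (\<gamma> j)" if "j < l" "x \<in> B j" for j x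
    proof -
      have "(T ^^ h (restrict \<gamma> {..<l})) x \<in> A (restrict \<gamma> {..<l} j)"
        using B(2) that \<gamma> by blast
      then show ?thesis using that(1) by simp
    qed
    then show "\<exists>h\<ge>m. \<forall>j<l. \<forall>x\<in>B j. (T ^^ h) x \<in> A (\<gamma> j)" using h(1) \<gamma> by blast
  qed
qed

text \<open>Level \<open>m\<close> lists the nodes of depth \<open>m\<close> of \<open>r\<close>
  binary trees, the children of \<open>j\<close> being \<open>2 * j\<close> and
  \<open>2 * j + 1\<close>. The bound \<open>h \<ge> m\<close> supplies arbitrarily late return
  times.\<close>

locale return_scheme =
  fixes X :: "'a::metric_space set" and T :: "'a \<Rightarrow> 'a" and r :: nat
    and A :: "nat \<Rightarrow> nat \<Rightarrow> 'a set"
  assumes compact_X: "compact X" and T_into: "T ` X \<subseteq> X" and two_le: "2 \<le> r"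
    and dense: "densely_independent X T (A m) (r * 2 ^ m)"
    and closed_A: "j < r * 2 ^ m \<Longrightarrow> closed (A m j)"
    and A_subset: "j < r * 2 ^ m \<Longrightarrow> A m j \<subseteq> X"
    and disjoint: "i < r * 2 ^ m \<Longrightarrow> j < r * 2 ^ m \<Longrightarrow> i \<noteq> j \<Longrightarrow> A m i \<inter> A m j = {}"
    and child: "j < r * 2 ^ Suc m \<Longrightarrow> A (Suc m) j \<subseteq> A m (j div 2)"
    and small: "j < r * 2 ^ Suc m \<Longrightarrow> x \<in> A (Suc m) j \<Longrightarrow> y \<in> A (Suc m) j \<Longrightarrow>
      dist x y \<le> 1 / real (Suc m)"
    and return: "(\<And>j. j < r * 2 ^ Suc m \<Longrightarrow> \<gamma> j < r * 2 ^ m) \<Longrightarrow>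
      \<exists>h\<ge>m. \<forall>j<r * 2 ^ Suc m. \<forall>x\<in>A (Suc m) j. (T ^^ h) x \<in> A m (\<gamma> j)"

text \<open>Dependent choice of the levels, each refining the previous one with parent map
  \<open>j div 2\<close>. Disjointness within a new level follows from its return property and from
  disjointness one level up.\<close>

lemma return_scheme_exists:
  fixes X :: "'a::metric_space set"
  assumes "compact X" "continuous_on X T" "T ` X \<subseteq> X" "2 \<le> r" "densely_independent X T A r"
    "\<And>j. j < r \<Longrightarrow> closed (A j) \<and> A j \<subseteq> X"
    "\<And>i j. i < r \<Longrightarrow> j < r \<Longrightarrow> i \<noteq> j \<Longrightarrow> A i \<inter> A j = {}"
  obtains B where "return_scheme X T r B" "B 0 = A"
proof -
  let ?P = "\<lambda>m B. (m = 0 \<longrightarrow> B = A) \<and> densely_independent X T B (r * 2 ^ m) \<and>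
    (\<forall>j<r * 2 ^ m. closed (B j) \<and> B j \<subseteq> X) \<and>
    (\<forall>i<r * 2 ^ m. \<forall>j<r * 2 ^ m. i \<noteq> j \<longrightarrow> B i \<inter> B j = {})"
  let ?Q = "\<lambda>m B C. (\<forall>j<r * 2 ^ Suc m. C j \<subseteq> B (j div 2) \<and>
      (\<forall>x\<in>C j. \<forall>y\<in>C j. dist x y \<le> 1 / real (Suc m))) \<and>
    (\<forall>\<gamma>. (\<forall>j<r * 2 ^ Suc m. \<gamma> j < r * 2 ^ m) \<longrightarrow>
      (\<exists>h\<ge>m. \<forall>j<r * 2 ^ Suc m. \<forall>x\<in>C j. (T ^^ h) x \<in> B (\<gamma> j)))"
  have "\<exists>f. \<forall>m. ?P m (f m) \<and> ?Q m (f m) (f (Suc m))"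
  proof (rule dependent_nat_choice)
    show "\<exists>B. ?P 0 B" using assms(5-7) by (intro exI[of _ A]) simp
  next
    fix B m assume B: "?P m B"
    let ?k = "r * 2 ^ m" and ?l = "r * 2 ^ Suc m"
    have two: "2 \<le> ?k" using assms(4) mult_le_mono[of 2 r 1 "2 ^ m"] by simp
    have dense: "densely_independent X T B ?k" using B by blast
    have closed: "closed (B j)" if "j < ?k" for j using B that by blast
    have parent: "j div 2 < ?k" if "j < ?l" for j using that by simp
    have k0: "0 < ?k" using two by linarith
    have l2: "2 \<le> ?l" using two unfolding power_Suc by linarith
    have eps: "0 < 1 / real (Suc m)" by simp
    \<comment> \<open>The refinement needs a positive lower bound for return times, so
      \<open>Suc m\<close> is requested and later weakened to \<open>m\<close>.\<close>
    from densely_independent_refine[OF assms(1-3) k0 l2 dense closed parent zero_less_Suc[of m] eps]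
    obtain C where C: "densely_independent X T C ?l"
      "\<forall>j<?l. closed (C j) \<and> C j \<subseteq> X \<and> C j \<subseteq> B (j div 2)"
      "\<forall>j<?l. \<forall>x\<in>C j. \<forall>y\<in>C j. dist x y \<le> 1 / real (Suc m)"
      "\<forall>\<gamma>. (\<forall>j<?l. \<gamma> j < ?k) \<longrightarrow> (\<exists>h\<ge>Suc m. \<forall>j<?l. \<forall>x\<in>C j. (T ^^ h) x \<in> B (\<gamma> j))" .
    have "C i \<inter> C j = {}" if ij: "i < ?l" "j < ?l" "i \<noteq> j" for i j
    proof -
      \<comment> \<open>The index map sending \<open>i\<close> to 1 and all else to 0 is realised by
        one power of \<open>T\<close>, which separates \<open>C i\<close> from every other
        \<open>C j\<close>.\<close>
      have "of_bool (j' = i) < ?k" for j'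
        using two by (cases "j' = i"; simp only: of_bool_eq simp_thms; linarith)
      then obtain h where h: "\<forall>j'<?l. \<forall>x\<in>C j'. (T ^^ h) x \<in> B (of_bool (j' = i))"
        using C(4)[rule_format, of "\<lambda>j'. of_bool (j' = i)"] by auto
      have "1 < ?k" using two by linarith
      then have "B 1 \<inter> B 0 = {}" using B k0 by (metis one_neq_zero)
      moreover have "(T ^^ h) x \<in> B 1" if "x \<in> C i" for x
        using h[rule_format, OF ij(1) that] by simp
      moreover have "(T ^^ h) x \<in> B 0" if "x \<in> C j" for x
        using h[rule_format, OF ij(2) that] ij(3) by simp
      ultimately show ?thesis by blast
    qed
    then have P: "?P (Suc m) C" using C(1,2) by blast
    have Q: "?Q m B C"
    proof (intro conjI allI impI)
      fix \<gamma> assume "\<forall>j<?l. \<gamma> j < ?k"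
      then have "\<exists>h\<ge>Suc m. \<forall>j<?l. \<forall>x\<in>C j. (T ^^ h) x \<in> B (\<gamma> j)" by (intro C(4)[rule_format]) blast
      then show "\<exists>h\<ge>m. \<forall>j<?l. \<forall>x\<in>C j. (T ^^ h) x \<in> B (\<gamma> j)" using Suc_leD by blast
    qed (use C(2,3) in blast)+
    show "\<exists>C. ?P (Suc m) C \<and> ?Q m B C" by (rule exI, rule conjI[OF P Q])
  qed
  then obtain f where f: "\<forall>m. ?P m (f m) \<and> ?Q m (f m) (f (Suc m))" ..
  have P: "?P m (f m)" and Q: "?Q m (f m) (f (Suc m))" for m
    using spec[OF f, of m] by (rule conjunct1, rule conjunct2)
  have "return_scheme X T r f"
  proof
    fix m \<gamma> assume "\<And>j. j < r * 2 ^ Suc m \<Longrightarrow> \<gamma> j < r * 2 ^ m"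
    then show "\<exists>h\<ge>m. \<forall>j<r * 2 ^ Suc m. \<forall>x\<in>f (Suc m) j. (T ^^ h) x \<in> f m (\<gamma> j)"
      using Q[of m, THEN conjunct2, rule_format, of \<gamma>] by blast
  next
    fix m j x y assume "j < r * 2 ^ Suc m" "x \<in> f (Suc m) j" "y \<in> f (Suc m) j"
    then show "dist x y \<le> 1 / real (Suc m)" using Q[of m, THEN conjunct1] by blast
  next
    fix m j assume "j < r * 2 ^ Suc m"
    then show "f (Suc m) j \<subseteq> f m (j div 2)" using Q[of m, THEN conjunct1] by blast
  next
    fix m i j :: nat assume "i < r * 2 ^ m" "j < r * 2 ^ m" "i \<noteq> j"
    then show "f m i \<inter> f m j = {}" using P[of m] by blast
  next
    fix m j :: nat assume "j < r * 2 ^ m"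
    then show "closed (f m j)" "f m j \<subseteq> X" using P[of m] by blast+
  next
    show "densely_independent X T (f m) (r * 2 ^ m)" for m using P[of m] by blast
  qed (rule assms)+
  then show ?thesis using that[of f] P[of 0] by blast
qed

section \<open>Limit points along the branches of the scheme\<close>

lemma eventually_inverse_Suc_less:
  "0 < (e :: real) \<Longrightarrow> \<forall>\<^sub>F m in sequentially. 1 / real (Suc m) < e"
  using order_tendstoD(2)[OF LIMSEQ_inverse_real_of_nat] by (simp add: inverse_eq_divide)

lemma nbhd_eventually_cball:
  assumes "nbhd X x V"
  shows "\<forall>\<^sub>F m in sequentially. X \<inter> cball x (1 / real (Suc m)) \<subseteq> V"
proof -
  obtain U where U: "openin (top_of_set X) U" "x \<in> U" "U \<subseteq> V"
    using assms unfolding nbhd_def by blast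
  then obtain e where e: "0 < e" "ball x e \<inter> X \<subseteq> U"
    unfolding openin_contains_ball by blast
  from eventually_inverse_Suc_less[OF e(1)] show ?thesis
    by eventually_elim (use e(2) U(3) in force)
qed

text \<open>The node at depth \<open>m\<close> below root \<open>i\<close>: each step appends a
  binary digit of \<open>a\<close> to the index.\<close>

primrec branch :: "nat \<Rightarrow> (nat \<Rightarrow> bool) \<Rightarrow> nat \<Rightarrow> nat" where
  "branch i a 0 = i"
| "branch i a (Suc m) = 2 * branch i a m + of_bool (a m)"

lemma branch_less: "i < r \<Longrightarrow> branch i a m < r * 2 ^ m"
  by (induction m) (auto simp: of_bool_def)

lemma branch_cong: "(\<And>n. n < m \<Longrightarrow> a n = b n) \<Longrightarrow> branch i a m = branch i b m"
  by (induction m) auto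

lemma branch_inject:
  assumes "branch i a m = branch i b m" "n < m"
  shows "a n = b n"
  using assms
proof (induction m)
  case (Suc m)
  have "(2 * branch i a m + of_bool (a m)) div 2 = (2 * branch i b m + of_bool (b m)) div 2"
    "(2 * branch i a m + of_bool (a m)) mod 2 = (2 * branch i b m + of_bool (b m)) mod 2"
    using Suc.prems(1) by simp_all
  then have "branch i a m = branch i b m" "a m = b m"
    by (auto simp: of_bool_def split: if_splits)
  then show ?case using Suc by (auto simp: less_Suc_eq)
qed simp

context return_scheme
begin

lemma A_nonempty:
  assumes "j < r * 2 ^ m"
  shows "A m j \<noteq> {}"
proof -
  have "2 \<le> r * 2 ^ m" using two_le mult_le_mono[of 2 r 1 "2 ^ m"] by simp
  then show ?thesis
    \<comment> \<open>An empty set would be covered by the empty family, which contains no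
      \<open>C\<close>.\<close>
    using densely_independent_finite_cover[of "{}", OF _ dense _ assms] by auto
qed

text \<open>For \<open>i < r\<close> the choice is unambiguous, because diameters along a branch
  tend to 0.\<close>

definition point :: "nat \<Rightarrow> (nat \<Rightarrow> bool) \<Rightarrow> 'a" where
  "point i a = (SOME x. \<forall>m. x \<in> A m (branch i a m))"

text \<open>Cantor's intersection theorem: the sets along a branch are nonempty, closed and
  decreasing in a compact space.\<close>

lemma point_mem:
  assumes "i < r"
  shows "point i a \<in> A m (branch i a m)"
proof -
  let ?F = "\<lambda>m. A m (branch i a m)"
  have less: "branch i a m < r * 2 ^ m" for m using assms by (rule branch_less)
  have "?F (Suc m) \<subseteq> ?F m" for m
    using child[OF less[of "Suc m"]] by (simp add: of_bool_def split: if_splits)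
  then have "?F n \<subseteq> ?F m" if "m \<le> n" for m n
    using lift_Suc_antimono_le[of ?F m n] that by blast
  then have F_max: "?F (Max (insert 0 M)) \<subseteq> (\<Inter>m\<in>M. ?F m)" if "finite M" for M
    using that by (intro INT_greatest) simp
  have "X \<inter> (\<Inter>m. ?F m) \<noteq> {}"
  proof (rule compact_imp_fip_image[OF compact_X])
    fix M :: "nat set" assume "finite M"
    obtain x where x: "x \<in> ?F (Max (insert 0 M))" using A_nonempty[OF less] by blast
    then have "x \<in> (\<Inter>m\<in>M. ?F m)" using F_max[OF \<open>finite M\<close>] by (rule subsetD[rotated])
    moreover have "x \<in> X" using A_subset[OF less] x by (rule subsetD)
    ultimately show "X \<inter> (\<Inter>m\<in>M. ?F m) \<noteq> {}" by blast
  qed (rule closed_A[OF less])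
  then have "\<exists>x. \<forall>m. x \<in> ?F m" by blast
  then have "\<forall>m. point i a \<in> ?F m" unfolding point_def by (rule someI_ex)
  then show ?thesis ..
qed

lemma point_in_X: "i < r \<Longrightarrow> point i a \<in> X"
  using point_mem[of i a 0] A_subset[of i 0] by auto

lemma dist_point_le:
  assumes "i < r" "x \<in> A (Suc m) (branch i a (Suc m))"
  shows "dist (point i a) x \<le> 1 / real (Suc m)"
  using small[OF branch_less[OF assms(1)] point_mem[OF assms(1)] assms(2)] .

text \<open>Each pair of disjoint nonempty compact sets has positive distance, attained through
  \<open>infdist\<close>, and a level has finitely many pairs.\<close>

lemma level_separation:
  obtains \<delta> where "0 < \<delta>"
    "\<And>i j x y. i < r * 2 ^ m \<Longrightarrow> j < r * 2 ^ m \<Longrightarrow> i \<noteq> j \<Longrightarrow> x \<in> A m i \<Longrightarrow> y \<in> A m j \<Longrightarrow>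
       \<delta> \<le> dist x y"
proof -
  let ?S = "{(i, j). i < r * 2 ^ m \<and> j < r * 2 ^ m \<and> i \<noteq> j}"
  have "\<exists>d>0. \<forall>x\<in>A m i. \<forall>y\<in>A m j. d \<le> dist x y" if "(i, j) \<in> ?S" for i j
  proof -
    have ij: "i < r * 2 ^ m" "j < r * 2 ^ m" "i \<noteq> j" using that by auto
    have "compact (A m i)"
      using compact_Int_closed[OF compact_X closed_A[OF ij(1)]] A_subset[OF ij(1)]
      by (simp add: Int_absorb1)
    then obtain z where z: "z \<in> A m i" "\<forall>x\<in>A m i. infdist z (A m j) \<le> infdist x (A m j)"
      using continuous_attains_inf[OF _ A_nonempty[OF ij(1)] continuous_on_infdist[OF continuous_on_id]]
      by blast
    have "z \<notin> A m j" using z(1) disjoint[OF ij] by blast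
    then have "0 < infdist z (A m j)"
      using in_closed_iff_infdist_zero[OF closed_A[OF ij(2)] A_nonempty[OF ij(2)]] infdist_nonneg
      by (metis less_le)
    moreover have "infdist z (A m j) \<le> dist x y" if "x \<in> A m i" "y \<in> A m j" for x y
      using z(2) that infdist_le[OF that(2), of x] by force
    ultimately show ?thesis by blast
  qed
  then have "\<forall>q\<in>?S. \<exists>d>0. \<forall>x\<in>A m (fst q). \<forall>y\<in>A m (snd q). d \<le> dist x y" by auto
  from bchoice[OF this] obtain D where
    D': "\<forall>q\<in>?S. 0 < D q \<and> (\<forall>x\<in>A m (fst q). \<forall>y\<in>A m (snd q). D q \<le> dist x y)" ..
  have D: "0 < D (i, j)" "x \<in> A m i \<Longrightarrow> y \<in> A m j \<Longrightarrow> D (i, j) \<le> dist x y"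
    if "(i, j) \<in> ?S" for i j x y
    using D'[rule_format, OF that] by auto
  \<comment> \<open>Inserting 1 guarantees a nonempty set for \<open>Min\<close>.\<close>
  let ?M = "insert 1 (D ` ?S)"
  have "?S \<subseteq> {..<r * 2 ^ m} \<times> {..<r * 2 ^ m}" by auto
  then have fin: "finite ?M" using finite_subset by fastforce
  show ?thesis
  proof
    show "0 < Min ?M" using fin D(1) by (subst Min_gr_iff) auto
    fix i j x y assume *: "i < r * 2 ^ m" "j < r * 2 ^ m" "i \<noteq> j" "x \<in> A m i" "y \<in> A m j"
    then have "Min ?M \<le> D (i, j)" using fin by (intro Min_le) auto
    also have "\<dots> \<le> dist x y" using D(2) * by simp
    finally show "Min ?M \<le> dist x y" .
  qed
qed

end

section \<open>Comparison with the ternary Cantor set\<close>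

text \<open>Taking \<open>e\<close> to be a supposed positive distance shows that \<open>f\<close>
  and \<open>g\<close> identify the same parameters. Hence \<open>f a\<close> and \<open>g a\<close>
  correspond well-definedly, uniformly continuously in both directions.\<close>

lemma homeomorphic_range:
  fixes f :: "'c \<Rightarrow> 'a::metric_space" and g :: "'c \<Rightarrow> 'b::metric_space"
  assumes fg: "\<And>e. 0 < e \<Longrightarrow> \<exists>d>0. \<forall>a b. dist (f a) (f b) < d \<longrightarrow> dist (g a) (g b) < e"
    and gf: "\<And>e. 0 < e \<Longrightarrow> \<exists>d>0. \<forall>a b. dist (g a) (g b) < d \<longrightarrow> dist (f a) (f b) < e"
  shows "range f homeomorphic range g"
proof -
  have g_eq: "g a = g b" if "f a = f b" for a b
  proof (rule ccontr)
    assume "g a \<noteq> g b"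
    then show False using fg[of "dist (g a) (g b)"] that by force
  qed
  have f_eq: "f a = f b" if "g a = g b" for a b
  proof (rule ccontr)
    assume "f a \<noteq> f b"
    then show False using gf[of "dist (f a) (f b)"] that by force
  qed
  let ?u = "\<lambda>x. g (inv f x)" and ?v = "\<lambda>y. f (inv g y)"
  have u: "?u (f a) = g a" for a by (rule g_eq) (simp add: f_inv_into_f)
  have v: "?v (g a) = f a" for a by (rule f_eq) (simp add: f_inv_into_f)
  have "homeomorphism (range f) (range g) ?u ?v"
    unfolding homeomorphism_def
  proof (intro conjI)
    show "continuous_on (range f) ?u"
      unfolding continuous_on_iff
    proof (intro ballI allI impI)
      fix x and e :: real assume "x \<in> range f" "0 < e"
      then obtain a d where "x = f a" "0 < d" "\<forall>a b. dist (f a) (f b) < d \<longrightarrow> dist (g a) (g b) < e"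
        using fg by blast
      then show "\<exists>d>0. \<forall>x'\<in>range f. dist x' x < d \<longrightarrow> dist (?u x') (?u x) < e"
        by (intro exI[of _ d]) (auto simp: u)
    qed
    show "continuous_on (range g) ?v"
      unfolding continuous_on_iff
    proof (intro ballI allI impI)
      fix x and e :: real assume "x \<in> range g" "0 < e"
      then obtain a d where "x = g a" "0 < d" "\<forall>a b. dist (g a) (g b) < d \<longrightarrow> dist (f a) (f b) < e"
        using gf by blast
      then show "\<exists>d>0. \<forall>x'\<in>range g. dist x' x < d \<longrightarrow> dist (?v x') (?v x) < e"
        by (intro exI[of _ d]) (auto simp: v)
    qed
  qed (auto simp: u v image_iff f_inv_into_f)
  then show ?thesis unfolding homeomorphic_def by blast
qed

definition ternary :: "(nat \<Rightarrow> bool) \<Rightarrow> real" where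
  "ternary a = (\<Sum>n. (if a n then 2 else 0) / 3 ^ Suc n)"

text \<open>The terms after position \<open>m\<close> are dominated by a geometric series with sum
  \<open>1 / 3 ^ Suc m\<close>.\<close>

lemma ternary_leading_term:
  fixes u :: "nat \<Rightarrow> real"
  assumes "\<And>n. \<bar>u n\<bar> \<le> 2 / 3 ^ Suc n" "\<And>n. n < m \<Longrightarrow> u n = 0"
  shows "\<bar>suminf u - u m\<bar> \<le> 1 / 3 ^ Suc m"
proof -
  have geo: "(\<lambda>n. 2 / 3 ^ Suc (n + Suc m)) sums (1 / 3 ^ Suc m :: real)"
  proof -
    have "(\<lambda>n. 2 / 3 ^ Suc (Suc m) * (1 / 3) ^ n) sums (2 / 3 ^ Suc (Suc m) * (1 / (1 - 1 / 3)) :: real)"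
      by (intro sums_mult geometric_sums) simp
    then show ?thesis by (simp add: power_add field_simps)
  qed
  have "summable (\<lambda>n. 2 * (1 / 3) ^ Suc n :: real)"
    by (intro summable_mult) (simp only: summable_Suc_iff summable_geometric_iff, simp)
  then have summ: "summable (\<lambda>n. \<bar>u n\<bar>)"
    by (rule summable_comparison_test') (use assms(1) in \<open>simp add: power_divide\<close>)
  then have summ': "summable (\<lambda>n. \<bar>u (n + Suc m)\<bar>)" by (rule summable_ignore_initial_segment)
  have "suminf u = (\<Sum>n. u (n + Suc m)) + (\<Sum>n<Suc m. u n)"
    using summ summable_rabs_cancel by (intro suminf_split_initial_segment) blast
  moreover have "(\<Sum>n<Suc m. u n) = u m" using assms(2) by simp
  moreover have "\<bar>\<Sum>n. u (n + Suc m)\<bar> \<le> (\<Sum>n. \<bar>u (n + Suc m)\<bar>)"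
    using summ' by (rule summable_rabs)
  moreover have "(\<Sum>n. \<bar>u (n + Suc m)\<bar>) \<le> (\<Sum>n. 2 / 3 ^ Suc (n + Suc m))"
    by (intro suminf_le summ' sums_summable[OF geo] assms(1))
  ultimately show ?thesis using sums_unique[OF geo] by simp
qed

lemma ternary_diff:
  assumes "\<And>n. n < m \<Longrightarrow> a n = b n"
  shows "\<bar>ternary a - ternary b - ((if a m then 2 else 0) - (if b m then 2 else 0)) / 3 ^ Suc m\<bar>
    \<le> 1 / 3 ^ Suc m"
proof -
  have summ: "summable (\<lambda>n. (if c n then 2 else 0) / 3 ^ Suc n :: real)" for c
  proof -
    have "summable (\<lambda>n. 2 * (1 / 3) ^ Suc n :: real)"
      by (intro summable_mult) (simp only: summable_Suc_iff summable_geometric_iff, simp)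
    then show ?thesis by (rule summable_comparison_test') (simp add: power_divide)
  qed
  let ?u = "\<lambda>n. (if a n then 2 else 0) / 3 ^ Suc n - (if b n then 2 else 0) / 3 ^ Suc n :: real"
  have "\<bar>suminf ?u - ?u m\<bar> \<le> 1 / 3 ^ Suc m"
    by (rule ternary_leading_term) (use assms in auto)
  moreover have "suminf ?u = ternary a - ternary b"
    unfolding ternary_def by (rule suminf_diff[symmetric]) (rule summ)+
  ultimately show ?thesis by (simp only: diff_divide_distrib)
qed

lemma ternary_close:
  assumes "\<And>n. n < m \<Longrightarrow> a n = b n"
  shows "dist (ternary a) (ternary b) \<le> 1 / 3 ^ m"
proof -
  have "\<bar>((if a m then 2 else 0) - (if b m then 2 else 0)) / 3 ^ Suc m\<bar> \<le> (2 / 3 ^ Suc m :: real)"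
    by (simp add: abs_if)
  then have "\<bar>ternary a - ternary b\<bar> \<le> 1 / 3 ^ Suc m + 2 / 3 ^ Suc m"
    using ternary_diff[of m a b, OF assms] by linarith
  then show ?thesis by (simp add: dist_real_def)
qed

text \<open>At the first difference \<open>l\<close> the digits contribute
  \<open>2 / 3 ^ Suc l\<close> and the tail at most half of that, so the values are at least
  \<open>1 / 3 ^ Suc l\<close> apart; \<open>l < m\<close> makes this too large.\<close>

lemma ternary_agree:
  assumes "dist (ternary a) (ternary b) < 1 / 3 ^ m" "n < m"
  shows "a n = b n"
proof (rule ccontr)
  assume "a n \<noteq> b n"
  define l where "l = (LEAST n. a n \<noteq> b n)"
  have l: "a l \<noteq> b l" unfolding l_def using \<open>a n \<noteq> b n\<close> by (rule LeastI)
  have "l \<le> n" unfolding l_def using \<open>a n \<noteq> b n\<close> by (rule Least_le)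
  have "a i = b i" if "i < l" for i using not_less_Least that unfolding l_def by blast
  from ternary_diff[of l a b, OF this]
  have d: "\<bar>ternary a - ternary b - ((if a l then 2 else 0) - (if b l then 2 else 0)) / 3 ^ Suc l\<bar>
    \<le> 1 / 3 ^ Suc l" .
  have "\<bar>((if a l then 2 else 0) - (if b l then 2 else 0)) / 3 ^ Suc l :: real\<bar> = 2 * (1 / 3 ^ Suc l)"
    using l by auto
  with d have "1 / 3 ^ Suc l \<le> \<bar>ternary a - ternary b\<bar>" by linarith
  moreover have "1 / 3 ^ m \<le> (1 / 3 ^ Suc l :: real)"
    using \<open>l \<le> n\<close> assms(2) by (intro divide_left_mono power_increasing) auto
  ultimately show False using assms(1) by (simp add: dist_real_def)
qed

context return_scheme
begin

text \<open>Points closer than the separation of level \<open>m\<close> share their branch to depth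
  \<open>m\<close>, so their ternary values are close. Conversely, close ternary values share many
  digits and hence a set of small diameter.\<close>

lemma is_cantor_set_points:
  assumes "i < r"
  shows "is_cantor_set (range (point i))"
proof -
  have "range (point i) homeomorphic range ternary"
  proof (rule homeomorphic_range)
    fix e :: real assume "0 < e"
    then obtain m where m: "(1 / 3) ^ m < e" using real_arch_pow_inv[of e "1/3"] by auto
    obtain \<delta> where \<delta>: "0 < \<delta>" "\<And>i j x y. i < r * 2 ^ m \<Longrightarrow> j < r * 2 ^ m \<Longrightarrow> i \<noteq> j \<Longrightarrow>
        x \<in> A m i \<Longrightarrow> y \<in> A m j \<Longrightarrow> \<delta> \<le> dist x y" using level_separation[of m] by blast
    have "dist (ternary a) (ternary b) < e" if "dist (point i a) (point i b) < \<delta>" for a b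
    proof -
      have "branch i a m = branch i b m"
        using \<delta>(2)[OF branch_less[OF assms] branch_less[OF assms] _ point_mem[OF assms] point_mem[OF assms]]
          that by (metis not_le)
      then have "dist (ternary a) (ternary b) \<le> 1 / 3 ^ m"
        by (intro ternary_close) (rule branch_inject)
      then show ?thesis using m by (simp add: power_divide)
    qed
    then show "\<exists>d>0. \<forall>a b. dist (point i a) (point i b) < d \<longrightarrow> dist (ternary a) (ternary b) < e"
      using \<delta>(1) by blast
  next
    fix e :: real assume "0 < e"
    then obtain m where m: "1 / real (Suc m) < e" using nat_approx_posE by blast
    have "dist (point i a) (point i b) < e" if "dist (ternary a) (ternary b) < 1 / 3 ^ Suc m" for a b
    proof -
      have "branch i b (Suc m) = branch i a (Suc m)"
        using ternary_agree[OF that] by (intro branch_cong) simp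
      then have "dist (point i a) (point i b) \<le> 1 / real (Suc m)"
        using point_mem[OF assms, of b "Suc m"] by (intro dist_point_le assms) simp
      then show ?thesis using m by simp
    qed
    then show "\<exists>d>0. \<forall>a b. dist (ternary a) (ternary b) < d \<longrightarrow> dist (point i a) (point i b) < e"
      by (intro exI[of _ "1 / 3 ^ Suc m"]) auto
  qed
  moreover have "range ternary = cantor_ternary"
    unfolding cantor_ternary_def ternary_def ..
  ultimately show ?thesis by (simp add: is_cantor_set_def)
qed

section \<open>IE-tuples of limit points and their simultaneous returns\<close>

abbreviation points :: "'a set" where
  "points \<equiv> \<Union>i<r. range (point i)"

lemma points_coords:
  assumes "set ys \<subseteq> points"
  obtains P a where "\<And>i. i < length ys \<Longrightarrow> P i < r \<and> ys ! i = point (P i) (a i)"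
proof -
  have "\<forall>i. \<exists>p a. i < length ys \<longrightarrow> p < r \<and> ys ! i = point p a"
  proof
    fix i
    show "\<exists>p a. i < length ys \<longrightarrow> p < r \<and> ys ! i = point p a"
      using assms nth_mem[of i ys] by (cases "i < length ys") blast+
  qed
  then show ?thesis using that by metis
qed

text \<open>At a deep level the set containing each \<open>ys ! i\<close> lies in the prescribed
  neighbourhood. The level is densely independent, and reindexing permits repeated entries.\<close>

lemma IE_tuple_points:
  assumes "ys \<noteq> []" "set ys \<subseteq> points"
  shows "IE_tuple isZ X T ys"
  unfolding IE_tuple_def
proof (intro conjI allI impI assms(1))
  show "set ys \<subseteq> X"
  proof
    fix y assume "y \<in> set ys"
    then obtain i a where "i < r" "y = point i a" using assms(2) by blast
    then show "y \<in> X" using point_in_X by simp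
  qed
  fix Us assume Us: "length Us = length ys \<and> (\<forall>i<length ys. nbhd X (ys ! i) (Us ! i))"
  obtain P a where Pa: "\<And>i. i < length ys \<Longrightarrow> P i < r \<and> ys ! i = point (P i) (a i)"
    using points_coords[OF assms(2)] by blast
  have "\<forall>\<^sub>F m in sequentially. X \<inter> cball (ys ! i) (1 / real (Suc m)) \<subseteq> Us ! i" if "i < length ys" for i
    using Us that by (intro nbhd_eventually_cball) blast
  then have "\<forall>\<^sub>F m in sequentially. \<forall>i\<in>{..<length ys}. X \<inter> cball (ys ! i) (1 / real (Suc m)) \<subseteq> Us ! i"
    by (intro eventually_ball_finite) auto
  from eventually_happens'[OF sequentially_bot this]
  obtain m where m: "\<And>i. i < length ys \<Longrightarrow> X \<inter> cball (ys ! i) (1 / real (Suc m)) \<subseteq> Us ! i"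
    by (auto simp del: of_nat_Suc)
  have "densely_independent X T (\<lambda>i. Us ! i) (length Us)"
  proof (rule densely_independent_comp[OF dense])
    fix i assume i: "i < length Us"
    let ?b = "branch (P i) (a i) (Suc m)"
    have Pi: "P i < r" "ys ! i = point (P i) (a i)" using Pa i Us by auto
    have "A (Suc m) ?b \<subseteq> X \<inter> cball (ys ! i) (1 / real (Suc m))"
      using dist_point_le[OF Pi(1)] A_subset[OF branch_less[OF Pi(1)]] Pi(2)
      by (auto simp del: branch.simps of_nat_Suc)
    then show "?b < r * 2 ^ Suc m \<and> A (Suc m) ?b \<subseteq> Us ! i"
      using m[of i] i Us branch_less[OF Pi(1), of "a i" "Suc m"] by (metis subset_trans)
  qed
  then show "\<exists>J \<subseteq> actG isZ. indep_set X T Us J \<and> pos_density isZ J"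
    using T_into Us assms(1) by (intro indep_set_of_densely_independent) auto
qed

text \<open>Distinct points eventually lie in different sets of a level, so some index map sends
  each of these sets to the set around its target one level up; the return property realises this
  map at arbitrarily late times.\<close>

lemma liminf_points:
  assumes "ys \<noteq> []" "length ys' = length ys" "distinct ys" "set ys \<subseteq> points" "set ys' \<subseteq> points"
  shows "liminf (\<lambda>n. ereal (Max ((\<lambda>i. dist ((T ^^ n) (ys ! i)) (ys' ! i)) ` {..<length ys}))) = 0"
    (is "liminf ?f = 0")
proof (rule antisym)
  have "0 \<le> ?f n" for n
  proof -
    have "0 \<le> dist ((T ^^ n) (ys ! 0)) (ys' ! 0)" by simp
    also have "\<dots> \<le> Max ((\<lambda>i. dist ((T ^^ n) (ys ! i)) (ys' ! i)) ` {..<length ys})"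
      using assms(1) by (intro Max_ge) auto
    finally show ?thesis by simp
  qed
  then show "0 \<le> liminf ?f" by (intro Liminf_bounded always_eventually allI)
  obtain P a where Pa: "\<And>i. i < length ys \<Longrightarrow> P i < r \<and> ys ! i = point (P i) (a i)"
    using points_coords[OF assms(4)] by blast
  obtain P' a' where Pa': "\<And>i. i < length ys \<Longrightarrow> P' i < r \<and> ys' ! i = point (P' i) (a' i)"
    using points_coords[OF assms(5)] assms(2) by metis
  have close: "\<exists>n\<ge>N. ?f n < ereal e" if e: "0 < e" for N e
  proof -
    let ?I = "{..<length ys}"
    have "\<forall>\<^sub>F m in sequentially. \<forall>i\<in>?I. \<forall>j\<in>?I. i \<noteq> j \<longrightarrow> 1 / real (Suc m) < dist (ys ! i) (ys ! j)"
    proof (intro eventually_ball_finite ballI finite_lessThan)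
      fix i j assume "i \<in> ?I" "j \<in> ?I"
      then have "0 < dist (ys ! i) (ys ! j)" if "i \<noteq> j"
        using that assms(3) by (simp add: nth_eq_iff_index_eq)
      then show "\<forall>\<^sub>F m in sequentially. i \<noteq> j \<longrightarrow> 1 / real (Suc m) < dist (ys ! i) (ys ! j)"
        using eventually_inverse_Suc_less by (cases "i = j") auto
    qed
    then have "\<forall>\<^sub>F m in sequentially. N \<le> m \<and> 1 / real (Suc m) < e \<and>
        (\<forall>i\<in>?I. \<forall>j\<in>?I. i \<noteq> j \<longrightarrow> 1 / real (Suc m) < dist (ys ! i) (ys ! j))"
      by (intro eventually_conj eventually_ge_at_top eventually_inverse_Suc_less e)
    from eventually_happens'[OF sequentially_bot this]
    obtain m where m: "N \<le> m" "1 / real (Suc m) < e"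
      "\<And>i j. i < length ys \<Longrightarrow> j < length ys \<Longrightarrow> i \<noteq> j \<Longrightarrow> 1 / real (Suc m) < dist (ys ! i) (ys ! j)"
      by (auto simp del: of_nat_Suc)
    \<comment> \<open>Targets are taken at depth \<open>m + 1\<close>, where diameters are at most
      \<open>1 / (m + 1) < e\<close>; the return property then requires sources at depth
      \<open>m + 2\<close>.\<close>
    let ?b = "\<lambda>i. branch (P i) (a i) (Suc (Suc m))" and ?b' = "\<lambda>i. branch (P' i) (a' i) (Suc m)"
    have inj: "i = j" if ij: "i < length ys" "j < length ys" "?b i = ?b j" for i j
    proof (rule ccontr)
      assume "i \<noteq> j"
      have "dist (ys ! i) (ys ! j) \<le> 1 / real (Suc (Suc m))"
        using small[OF branch_less point_mem point_mem[of "P j" "a j" "Suc (Suc m)", folded ij(3)]] Pa ij(1,2)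
        by (metis (no_types, lifting))
      also have "\<dots> \<le> 1 / real (Suc m)" by (simp add: frac_le)
      finally show False using m(3)[OF ij(1,2) \<open>i \<noteq> j\<close>] by simp
    qed
    \<comment> \<open>Indices that contain none of the points go to the arbitrary legal index 0; on
      the others, injectivity of \<open>?b\<close> makes the choice unique.\<close>
    define \<gamma> where "\<gamma> j = (if \<exists>i<length ys. ?b i = j then ?b' (SOME i. i < length ys \<and> ?b i = j) else 0)" for j
    have \<gamma>b: "\<gamma> (?b i) = ?b' i" if "i < length ys" for i
    proof -
      have "(SOME i'. i' < length ys \<and> ?b i' = ?b i) = i"
        using that inj by (intro some_equality) blast+
      then show ?thesis using that unfolding \<gamma>_def by auto
    qed
    have "\<gamma> j < r * 2 ^ Suc m" for j
    proof (cases "\<exists>i<length ys. ?b i = j")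
      case True
      then obtain i where "i < length ys" "?b i = j" by blast
      then have "\<gamma> j = ?b' i" using \<gamma>b by blast
      then show ?thesis using branch_less Pa' \<open>i < length ys\<close> by metis
    next
      case False
      then show ?thesis unfolding \<gamma>_def using two_le by auto
    qed
    then obtain h where h: "Suc m \<le> h"
      "\<And>j x. j < r * 2 ^ Suc (Suc m) \<Longrightarrow> x \<in> A (Suc (Suc m)) j \<Longrightarrow> (T ^^ h) x \<in> A (Suc m) (\<gamma> j)"
      using return[of "Suc m" \<gamma>] by blast
    have "dist ((T ^^ h) (ys ! i)) (ys' ! i) < e" if i: "i < length ys" for i
    proof -
      have Pi: "P i < r" "P' i < r" "ys ! i = point (P i) (a i)" "ys' ! i = point (P' i) (a' i)"
        using Pa[OF i] Pa'[OF i] by auto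
      have "(T ^^ h) (ys ! i) \<in> A (Suc m) (?b' i)"
        using h(2)[OF branch_less[OF Pi(1)] point_mem[OF Pi(1)]] \<gamma>b[OF i] Pi(3) by metis
      then have "dist (ys' ! i) ((T ^^ h) (ys ! i)) \<le> 1 / real (Suc m)"
        unfolding Pi(4) by (intro dist_point_le Pi(2))
      then show ?thesis using m(2) by (simp add: dist_commute)
    qed
    then have "Max ((\<lambda>i. dist ((T ^^ h) (ys ! i)) (ys' ! i)) ` ?I) < e"
      using assms(1) by (subst Max_less_iff) auto
    then show ?thesis using h(1) m(1) by (intro exI[of _ h]) auto
  qed
  show "liminf ?f \<le> 0"
  proof (rule ccontr)
    assume "\<not> liminf ?f \<le> 0"
    then obtain e where e: "0 < ereal e" "ereal e < liminf ?f"
      using ereal_dense2[of 0 "liminf ?f"] by (auto simp: not_le)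
    from less_LiminfD[OF e(2)] obtain N where "\<forall>n\<ge>N. ereal e < ?f n"
      by (auto simp: eventually_sequentially)
    then show False using close[of e N] e(1) by (auto simp: less_le_not_le)
  qed
qed

end

section \<open>Disjoint closed balls around the given points and assembly\<close>

theorem theorem3p18:
  fixes X :: "'a::metric_space set" and T :: "'a \<Rightarrow> 'a" and isZ :: bool
    and k :: nat and xs :: "'a list" and A :: "nat \<Rightarrow> 'a set"
  assumes "compact X"
    and "continuous_on X T" and "T ` X = X"
    and "isZ \<longrightarrow> (\<exists>g. homeomorphism X X T g)"
    and "k \<ge> 2" and "length xs = k"
    and "\<not> (\<forall>i<k. \<forall>j<k. xs ! i = xs ! j)"
    and "IE_tuple isZ X T xs"
    and "\<forall>j<k. nbhd X (xs ! j) (A j)"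
  shows "\<exists>\<delta>::real. \<delta> > 0 \<and> (\<exists>Zs :: nat \<Rightarrow> 'a set.
           (\<forall>j<k. is_cantor_set (Zs j) \<and> Zs j \<subseteq> A j) \<and>
           (\<forall>ys. ys \<noteq> [] \<and> set ys \<subseteq> (\<Union>j<k. Zs j) \<longrightarrow> IE_tuple isZ X T ys) \<and>
           (\<forall>ys ys'. ys \<noteq> [] \<and> length ys' = length ys \<and> distinct ys \<and>
                set ys \<subseteq> (\<Union>j<k. Zs j) \<and> set ys' \<subseteq> (\<Union>j<k. Zs j) \<longrightarrow>
              liminf (\<lambda>n::nat. ereal (Max ((\<lambda>i. dist ((T ^^ n) (ys ! i)) (ys' ! i)) ` {..<length ys}))) = 0))"
proof -
  have TX: "T ` X \<subseteq> X" using assms(3) by simp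
  have xsX: "set xs \<subseteq> X" using assms(8) by (auto simp: IE_tuple_def)
  \<comment> \<open>Equal entries have no disjoint neighbourhoods, so the scheme starts from the
    distinct entries, and equal entries later receive the same Cantor set. The tuple is off the
    diagonal, whence \<open>2 \<le> r\<close>.\<close>
  define rs where "rs = remdups xs"
  define r where "r = length rs"
  have set_rs: "set rs = set xs" and "distinct rs" by (simp_all add: rs_def)
  have two: "2 \<le> r"
  proof -
    obtain i j where ij: "i < k" "j < k" "xs ! i \<noteq> xs ! j" using assms(7) by blast
    then have "card {xs ! i, xs ! j} \<le> card (set xs)"
      using assms(6) by (intro card_mono) auto
    then show ?thesis
      using ij(3) \<open>distinct rs\<close> set_rs by (simp add: r_def distinct_card[symmetric])
  qed
  \<comment> \<open>A radius below half of all distances between distinct entries makes the closed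
    balls disjoint; it is also small enough for the neighbourhoods \<open>A j\<close>.\<close>
  have "\<forall>\<^sub>F m in sequentially. (\<forall>j\<in>{..<k}. X \<inter> cball (xs ! j) (1 / real (Suc m)) \<subseteq> A j) \<and>
      (\<forall>x\<in>set xs. \<forall>y\<in>set xs. x \<noteq> y \<longrightarrow> 1 / real (Suc m) < dist x y / 2)"
  proof (intro eventually_conj eventually_ball_finite finite_lessThan finite_set ballI)
    fix j assume "j \<in> {..<k}"
    then show "\<forall>\<^sub>F m in sequentially. X \<inter> cball (xs ! j) (1 / real (Suc m)) \<subseteq> A j"
      using assms(9) by (intro nbhd_eventually_cball) simp
  next
    fix x y
    show "\<forall>\<^sub>F m in sequentially. x \<noteq> y \<longrightarrow> 1 / real (Suc m) < dist x y / 2"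
      using eventually_inverse_Suc_less[of "dist x y / 2"] by (cases "x = y") auto
  qed
  from eventually_happens'[OF sequentially_bot this]
  obtain m where m: "\<forall>j\<in>{..<k}. X \<inter> cball (xs ! j) (1 / real (Suc m)) \<subseteq> A j"
    "\<forall>x\<in>set xs. \<forall>y\<in>set xs. x \<noteq> y \<longrightarrow> 1 / real (Suc m) < dist x y / 2" by (elim exE conjE)
  define \<epsilon> where "\<epsilon> = 1 / real (Suc m)"
  have \<epsilon>: "0 < \<epsilon>" by (simp add: \<epsilon>_def)
  define N where "N x = X \<inter> cball x \<epsilon>" for x
  have "nbhd X x (N x)" if "x \<in> X" for x
    unfolding nbhd_def N_def using \<epsilon> that
    by (intro conjI exI[of _ "X \<inter> ball x \<epsilon>"] openin_open_Int open_ball) auto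
  then have "length (map N xs) = length xs \<and> (\<forall>i<length xs. nbhd X (xs ! i) (map N xs ! i))"
    using subsetD[OF xsX nth_mem] by simp
  moreover have "\<forall>Us. length Us = length xs \<and> (\<forall>i<length xs. nbhd X (xs ! i) (Us ! i)) \<longrightarrow>
      (\<exists>J \<subseteq> actG isZ. indep_set X T Us J \<and> pos_density isZ J)"
    using assms(8) unfolding IE_tuple_def by (elim conjE)
  ultimately obtain J where "J \<subseteq> actG isZ" "indep_set X T (map N xs) J" "pos_density isZ J"
    by blast
  then have dense_N: "densely_independent X T (\<lambda>i. map N xs ! i) (length (map N xs))"
    using assms(3) by (intro densely_independent_of_indep_set)
  have "\<exists>c<length xs. xs ! c = rs ! i" if "i < r" for i
    using that set_rs nth_mem[of i rs] by (auto simp: r_def in_set_conv_nth)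
  then obtain c where c: "\<And>i. i < r \<Longrightarrow> c i < length xs \<and> xs ! c i = rs ! i" by metis
  have dense: "densely_independent X T (\<lambda>i. N (rs ! i)) r"
    by (rule densely_independent_comp[OF dense_N, where c = c]) (use c in force)
  have "closed (N (rs ! i)) \<and> N (rs ! i) \<subseteq> X" for i
    unfolding N_def using compact_imp_closed[OF assms(1)] by auto
  moreover have "N (rs ! i) \<inter> N (rs ! j) = {}" if ij: "i < r" "j < r" "i \<noteq> j" for i j
  proof -
    have "rs ! i \<noteq> rs ! j" using ij \<open>distinct rs\<close> by (simp add: r_def nth_eq_iff_index_eq)
    then have *: "\<epsilon> < dist (rs ! i) (rs ! j) / 2"
      using m(2) ij set_rs nth_mem unfolding \<epsilon>_def r_def by metis
    show ?thesis
    proof (rule ccontr)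
      assume "N (rs ! i) \<inter> N (rs ! j) \<noteq> {}"
      then obtain x where "dist (rs ! i) x \<le> \<epsilon>" "dist (rs ! j) x \<le> \<epsilon>"
        unfolding N_def by auto
      then show False using * dist_triangle2[of "rs ! i" "rs ! j" x] by linarith
    qed
  qed
  ultimately obtain B where B: "return_scheme X T r B" "B 0 = (\<lambda>i. N (rs ! i))"
    using return_scheme_exists[OF assms(1,2) TX two dense] by blast
  interpret return_scheme X T r B by (rule B(1))
  have "\<exists>p<r. rs ! p = xs ! j" if "j < k" for j
    using that set_rs nth_mem[of j xs] assms(6) by (auto simp: r_def in_set_conv_nth)
  then obtain p where p: "\<And>j. j < k \<Longrightarrow> p j < r \<and> rs ! p j = xs ! j" by metis
  define Zs where "Zs j = range (point (p j))" for j
  have cantor: "is_cantor_set (Zs j)" and subset_A: "Zs j \<subseteq> A j" if j: "j < k" for j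
  proof -
    show "is_cantor_set (Zs j)" unfolding Zs_def using p[OF j] is_cantor_set_points by blast
    have "point (p j) a \<in> N (xs ! j)" for a
      using point_mem[of "p j" a 0] p[OF j] B(2) by simp
    moreover have "N (xs ! j) \<subseteq> A j" using m(1) j unfolding N_def \<epsilon>_def by blast
    ultimately show "Zs j \<subseteq> A j" unfolding Zs_def by blast
  qed
  have sub: "(\<Union>j<k. Zs j) \<subseteq> points" unfolding Zs_def using p by blast
  have "IE_tuple isZ X T ys" if "ys \<noteq> [] \<and> set ys \<subseteq> (\<Union>j<k. Zs j)" for ys
    using that by (elim conjE, intro IE_tuple_points) (assumption, erule subset_trans[OF _ sub])
  moreover have "liminf (\<lambda>n. ereal (Max ((\<lambda>i. dist ((T ^^ n) (ys ! i)) (ys' ! i)) ` {..<length ys}))) = 0"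
    if "ys \<noteq> [] \<and> length ys' = length ys \<and> distinct ys \<and>
      set ys \<subseteq> (\<Union>j<k. Zs j) \<and> set ys' \<subseteq> (\<Union>j<k. Zs j)" for ys ys'
    using that
    by (elim conjE, intro liminf_points) (assumption | erule subset_trans[OF _ sub])+
  ultimately show ?thesis
    by (intro exI[of _ "1::real"] exI[of _ Zs] conjI allI impI zero_less_one cantor subset_A)
qed

end
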